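(* Let $n\ge 1$ and let $(M^{2n+1},\phi,\zeta,\eta,g)$ be a para-Sasakian manifold. Suppose $M$ admits a proper $h$-almost Ricci-Yamabe soliton $(g,\zeta,\lambda,\alpha,\beta)$ with soliton vector field $\zeta$, i.e. there are smooth functions $h,\lambda:M\to\mathbb{R}$ and constants $\alpha,\beta\in\mathbb{R}$ with $\alpha\neq 0,1$ such that $$\frac{h}{2}\pounds_\zeta g+\alpha S+\Big(\lambda-\frac{\beta}{2}r\Big)g=0 .$$ Then $M$ is an Einstein manifold.
   Context: All objects are smooth. $\nabla$ is the Levi-Civita connection of the semi-Riemannian metric $g$, $R(X,Y)Z=\nabla_X\nabla_YZ-\nabla_Y\nabla_XZ-\nabla_{[X,Y]}Z$, $S(Y,Z)=\mathrm{tr}(X\mapsto R(X,Y)Z)$ is the Ricci tensor, $r$ the scalar curvature, $\pounds$ the Lie derivative. Einstein means $S=c\,g$ for a constant $c$. Almost paracontact metric manifold $(M^{2n+1},\phi,\zeta,\eta,g)$: $\phi$ is a $(1,1)$-tensor field, $\zeta$ a vector field, $\eta$ a 1-form, with $\phi^2=I-\eta\otimes\zeta$, $\eta(\zeta)=1$, the $\pm1$-eigendistributions of $\phi$ on $\ker\eta$ both have dimension $n$, and $g$ is a semi-Riemannian metric with $g(\phi X,\phi Y)=-g(X,Y)+\eta(X)\eta(Y)$. It follows that $\phi\zeta=0$, $\eta\circ\phi=0$, $\eta=g(\cdot,\zeta)$. Paracontact metric manifold: in addition $d\eta(X,Y)=g(X,\phi Y)$, with the convention $2d\eta(X,Y)=X\eta(Y)-Y\eta(X)-\eta([X,Y])$.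 Normal: the tensor $[\phi,\phi]-2d\eta\otimes\zeta$ vanishes, where $[\phi,\phi]$ is the Nijenhuis torsion of $\phi$. Para-Sasakian manifold: a normal paracontact metric manifold. Such a manifold satisfies $(\nabla_X\phi)Y=-g(X,Y)\zeta+\eta(Y)X$, $\nabla_X\zeta=-\phi X$, $R(X,Y)\zeta=\eta(X)Y-\eta(Y)X$ and $S(X,\zeta)=-2n\,\eta(X)$. *)

theory Defs
  imports "HOL-Analysis.Analysis" "HOL-Library.Function_Algebras"
begin

section \<open>Smooth functions on a manifold\<close>

text \<open>Tangent vectors will be functionals on real functions, so we use the pointwise vector space
  structure on function types.\<close>

instantiation "fun" :: (type, real_vector) real_vector
begin

definition scaleR_fun_def: "c *\<^sub>R f = (\<lambda>x. c *\<^sub>R f x)"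

instance
  by standard (simp_all add: scaleR_fun_def fun_eq_iff scaleR_add_right scaleR_add_left)

end

text \<open>Meaningful for open \<^term>\<open>S\<close> only, since the derivative is the unrestricted one.\<close>

primrec C_k_on :: "nat \<Rightarrow> 'a::real_normed_vector set \<Rightarrow> ('a \<Rightarrow> 'b::real_normed_vector) \<Rightarrow> bool" where
  "C_k_on 0 S f \<longleftrightarrow> continuous_on S f"
| "C_k_on (Suc k) S f \<longleftrightarrow>
     (\<forall>x\<in>S. f differentiable (at x)) \<and> (\<forall>v. C_k_on k S (\<lambda>x. frechet_derivative f (at x) v))"

definition C_infinity_on :: "'a::real_normed_vector set \<Rightarrow> ('a \<Rightarrow> 'b::real_normed_vector) \<Rightarrow> bool" where
  "C_infinity_on S f \<longleftrightarrow> (\<forall>k. C_k_on k S f)"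

text \<open>A manifold is a Hausdorff, second countable type \<open>'m\<close> together with an atlas, not necessarily
  maximal, of charts \<open>(U, \<psi>)\<close> with values in the Euclidean space \<open>'e\<close>. The function \<open>\<psi>\<close> is total,
  but only its values on \<open>U\<close> matter.\<close>

type_synonym ('m, 'e) atlas = "('m set \<times> ('m \<Rightarrow> 'e)) set"

definition smooth_atlas ::
  "('m::{t2_space, second_countable_topology}, 'e::euclidean_space) atlas \<Rightarrow> bool" where
  "smooth_atlas A \<longleftrightarrow>
     (\<Union>(U, \<psi>)\<in>A. U) = UNIV \<and>
     (\<forall>(U, \<psi>)\<in>A. open U \<and> open (\<psi> ` U) \<and> inj_on \<psi> U \<and>
                  homeomorphism U (\<psi> ` U) \<psi> (inv_into U \<psi>)) \<and>
     (\<forall>(U, \<psi>)\<in>A. \<forall>(V, \<theta>)\<in>A. C_infinity_on (\<psi> ` (U \<inter> V)) (\<theta> \<circ> inv_into U \<psi>))"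

definition smooth_functions ::
  "('m::{t2_space, second_countable_topology}, 'e::euclidean_space) atlas \<Rightarrow> ('m \<Rightarrow> real) set" where
  "smooth_functions A = {f. \<forall>(U, \<psi>)\<in>A. C_infinity_on (\<psi> ` U) (f \<circ> inv_into U \<psi>)}"


section \<open>Tangent vectors and tensor fields\<close>

type_synonym 'm tangent = "('m \<Rightarrow> real) \<Rightarrow> real"
type_synonym 'm vfield = "'m \<Rightarrow> 'm tangent"

text \<open>Tangent vectors are the derivations at \<^term>\<open>p\<close> of the algebra of smooth functions. They are
  extended by zero to non-smooth functions, so that they are equal iff they agree on smooth
  functions.\<close>

definition tangent_space ::
  "('m::{t2_space, second_countable_topology}, 'e::euclidean_space) atlas \<Rightarrow> 'm \<Rightarrow> 'm tangent set" where
  "tangent_space A p = {v.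
     (\<forall>f\<in>smooth_functions A. \<forall>g\<in>smooth_functions A.
        v (f + g) = v f + v g \<and> v (f * g) = f p * v g + g p * v f) \<and>
     (\<forall>c. \<forall>f\<in>smooth_functions A. v (c *\<^sub>R f) = c * v f) \<and>
     (\<forall>f. f \<notin> smooth_functions A \<longrightarrow> v f = 0)}"

definition lie_derivative_fun :: "'m vfield \<Rightarrow> ('m \<Rightarrow> real) \<Rightarrow> 'm \<Rightarrow> real" where
  "lie_derivative_fun X f = (\<lambda>p. X p f)"

definition vector_fields ::
  "('m::{t2_space, second_countable_topology}, 'e::euclidean_space) atlas \<Rightarrow> 'm vfield set" where
  "vector_fields A = {X. (\<forall>p. X p \<in> tangent_space A p) \<and>
     (\<forall>f\<in>smooth_functions A. lie_derivative_fun X f \<in> smooth_functions A)}"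

definition scale_field :: "('m \<Rightarrow> real) \<Rightarrow> 'm vfield \<Rightarrow> 'm vfield" where
  "scale_field f X = (\<lambda>p. f p *\<^sub>R X p)"

definition lie_bracket :: "'m vfield \<Rightarrow> 'm vfield \<Rightarrow> 'm vfield" where
  "lie_bracket X Y = (\<lambda>p f. X p (lie_derivative_fun Y f) - Y p (lie_derivative_fun X f))"

definition linear_on_set :: "'a::real_vector set \<Rightarrow> ('a \<Rightarrow> 'b::real_vector) \<Rightarrow> bool" where
  "linear_on_set T L \<longleftrightarrow>
     (\<forall>x\<in>T. \<forall>y\<in>T. L (x + y) = L x + L y) \<and> (\<forall>c. \<forall>x\<in>T. L (c *\<^sub>R x) = c *\<^sub>R L x)"

text \<open>Tensor fields are families of (multi)linear maps on the tangent spaces; such a family is smooth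
  iff it yields smooth results on smooth vector fields. The values outside the tangent spaces are
  irrelevant.\<close>

type_synonym 'm one_form = "'m \<Rightarrow> 'm tangent \<Rightarrow> real"
type_synonym 'm endo_field = "'m \<Rightarrow> 'm tangent \<Rightarrow> 'm tangent"
type_synonym 'm bilinear_field = "'m \<Rightarrow> 'm tangent \<Rightarrow> 'm tangent \<Rightarrow> real"

definition apply_form :: "'m one_form \<Rightarrow> 'm vfield \<Rightarrow> 'm \<Rightarrow> real" where
  "apply_form \<omega> X = (\<lambda>p. \<omega> p (X p))"

definition apply_endo :: "'m endo_field \<Rightarrow> 'm vfield \<Rightarrow> 'm vfield" where
  "apply_endo \<phi> X = (\<lambda>p. \<phi> p (X p))"

definition apply_bilinear :: "'m bilinear_field \<Rightarrow> 'm vfield \<Rightarrow> 'm vfield \<Rightarrow> 'm \<Rightarrow> real" where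
  "apply_bilinear g X Y = (\<lambda>p. g p (X p) (Y p))"

definition smooth_one_form ::
  "('m::{t2_space, second_countable_topology}, 'e::euclidean_space) atlas \<Rightarrow> 'm one_form \<Rightarrow> bool" where
  "smooth_one_form A \<omega> \<longleftrightarrow>
     (\<forall>p. linear_on_set (tangent_space A p) (\<omega> p)) \<and>
     (\<forall>X\<in>vector_fields A. apply_form \<omega> X \<in> smooth_functions A)"

definition smooth_endo_field ::
  "('m::{t2_space, second_countable_topology}, 'e::euclidean_space) atlas \<Rightarrow> 'm endo_field \<Rightarrow> bool" where
  "smooth_endo_field A \<phi> \<longleftrightarrow>
     (\<forall>p. \<phi> p ` tangent_space A p \<subseteq> tangent_space A p \<and> linear_on_set (tangent_space A p) (\<phi> p)) \<and>
     (\<forall>X\<in>vector_fields A. apply_endo \<phi> X \<in> vector_fields A)"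

definition smooth_bilinear_field ::
  "('m::{t2_space, second_countable_topology}, 'e::euclidean_space) atlas \<Rightarrow> 'm bilinear_field \<Rightarrow> bool" where
  "smooth_bilinear_field A g \<longleftrightarrow>
     (\<forall>p. \<forall>v\<in>tangent_space A p.
        linear_on_set (tangent_space A p) (g p v) \<and>
        linear_on_set (tangent_space A p) (\<lambda>u. g p u v)) \<and>
     (\<forall>X\<in>vector_fields A. \<forall>Y\<in>vector_fields A. apply_bilinear g X Y \<in> smooth_functions A)"


section \<open>Semi-Riemannian geometry\<close>

definition index_on :: "'a::real_vector set \<Rightarrow> ('a \<Rightarrow> 'a \<Rightarrow> real) \<Rightarrow> nat" where
  "index_on T b = Max {dim W | W. subspace W \<and> W \<subseteq> T \<and> (\<forall>w\<in>W. w \<noteq> 0 \<longrightarrow> b w w < 0)}"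

definition semi_riemannian_metric ::
  "('m::{t2_space, second_countable_topology}, 'e::euclidean_space) atlas \<Rightarrow> 'm bilinear_field \<Rightarrow> bool" where
  "semi_riemannian_metric A g \<longleftrightarrow>
     smooth_bilinear_field A g \<and>
     (\<forall>p. \<forall>v\<in>tangent_space A p. \<forall>w\<in>tangent_space A p. g p v w = g p w v) \<and>
     (\<forall>p. \<forall>v\<in>tangent_space A p. (\<forall>w\<in>tangent_space A p. g p v w = 0) \<longrightarrow> v = 0) \<and>
     (\<exists>\<nu>. \<forall>p. index_on (tangent_space A p) (g p) = \<nu>)"

type_synonym 'm connection = "'m vfield \<Rightarrow> 'm vfield \<Rightarrow> 'm vfield"

definition affine_connection ::
  "('m::{t2_space, second_countable_topology}, 'e::euclidean_space) atlas \<Rightarrow> 'm connection \<Rightarrow> bool" where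
  "affine_connection A D \<longleftrightarrow>
     (\<forall>X\<in>vector_fields A. \<forall>Y\<in>vector_fields A. D X Y \<in> vector_fields A) \<and>
     (\<forall>X\<in>vector_fields A. \<forall>Y\<in>vector_fields A. \<forall>Z\<in>vector_fields A.
        D (X + Y) Z = D X Z + D Y Z \<and> D X (Y + Z) = D X Y + D X Z) \<and>
     (\<forall>f\<in>smooth_functions A. \<forall>X\<in>vector_fields A. \<forall>Y\<in>vector_fields A.
        D (scale_field f X) Y = scale_field f (D X Y) \<and>
        D X (scale_field f Y) = scale_field (lie_derivative_fun X f) Y + scale_field f (D X Y))"

text \<open>By the fundamental theorem of semi-Riemannian geometry exactly one operation on smooth vector
  fields satisfies this predicate.\<close>

definition levi_civita_connection ::
  "('m::{t2_space, second_countable_topology}, 'e::euclidean_space) atlas \<Rightarrow>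
   'm bilinear_field \<Rightarrow> 'm connection \<Rightarrow> bool" where
  "levi_civita_connection A g D \<longleftrightarrow>
     affine_connection A D \<and>
     (\<forall>X\<in>vector_fields A. \<forall>Y\<in>vector_fields A. D X Y - D Y X = lie_bracket X Y) \<and>
     (\<forall>X\<in>vector_fields A. \<forall>Y\<in>vector_fields A. \<forall>Z\<in>vector_fields A.
        lie_derivative_fun X (apply_bilinear g Y Z) =
          apply_bilinear g (D X Y) Z + apply_bilinear g Y (D X Z))"

definition curvature :: "'m connection \<Rightarrow> 'm vfield \<Rightarrow> 'm vfield \<Rightarrow> 'm vfield \<Rightarrow> 'm vfield" where
  "curvature D X Y Z = D X (D Y Z) - D Y (D X Z) - D (lie_bracket X Y) Z"

text \<open>The trace of a linear endomorphism of a finite-dimensional subspace; it does not depend on the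
  choice of the basis.\<close>

definition trace_on :: "'a::real_vector set \<Rightarrow> ('a \<Rightarrow> 'a) \<Rightarrow> real" where
  "trace_on T L = (let B = (SOME B. independent B \<and> span B = T) in \<Sum>b\<in>B. representation B (L b) b)"

definition field_through ::
  "('m::{t2_space, second_countable_topology}, 'e::euclidean_space) atlas \<Rightarrow>
   'm \<Rightarrow> 'm tangent \<Rightarrow> 'm vfield" where
  "field_through A p v = (SOME X. X \<in> vector_fields A \<and> X p = v)"

text \<open>The pointwise trace of an operator on vector fields that is linear over the smooth functions.
  The value of such an operator at \<^term>\<open>p\<close> depends only on the value of its argument at \<^term>\<open>p\<close>, so
  the choice of the extending vector field does not matter.\<close>

definition field_trace ::
  "('m::{t2_space, second_countable_topology}, 'e::euclidean_space) atlas \<Rightarrow>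
   ('m vfield \<Rightarrow> 'm vfield) \<Rightarrow> 'm \<Rightarrow> real" where
  "field_trace A F p = trace_on (tangent_space A p) (\<lambda>v. F (field_through A p v) p)"

definition ricci_tensor ::
  "('m::{t2_space, second_countable_topology}, 'e::euclidean_space) atlas \<Rightarrow>
   'm connection \<Rightarrow> 'm vfield \<Rightarrow> 'm vfield \<Rightarrow> 'm \<Rightarrow> real" where
  "ricci_tensor A D Y Z = field_trace A (\<lambda>X. curvature D X Y Z)"

definition ricci_operator ::
  "('m::{t2_space, second_countable_topology}, 'e::euclidean_space) atlas \<Rightarrow>
   'm bilinear_field \<Rightarrow> 'm connection \<Rightarrow> 'm vfield \<Rightarrow> 'm vfield" where
  "ricci_operator A g D X = (\<lambda>p. THE q. q \<in> tangent_space A p \<and>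
     (\<forall>Y\<in>vector_fields A. g p q (Y p) = ricci_tensor A D X Y p))"

definition scalar_curvature ::
  "('m::{t2_space, second_countable_topology}, 'e::euclidean_space) atlas \<Rightarrow>
   'm bilinear_field \<Rightarrow> 'm connection \<Rightarrow> 'm \<Rightarrow> real" where
  "scalar_curvature A g D = field_trace A (ricci_operator A g D)"

definition lie_derivative_metric ::
  "'m vfield \<Rightarrow> 'm bilinear_field \<Rightarrow> 'm vfield \<Rightarrow> 'm vfield \<Rightarrow> 'm \<Rightarrow> real" where
  "lie_derivative_metric V g X Y =
     lie_derivative_fun V (apply_bilinear g X Y)
       - apply_bilinear g (lie_bracket V X) Y - apply_bilinear g X (lie_bracket V Y)"

definition einstein_manifold ::
  "('m::{t2_space, second_countable_topology}, 'e::euclidean_space) atlas \<Rightarrow>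
   'm bilinear_field \<Rightarrow> 'm connection \<Rightarrow> bool" where
  "einstein_manifold A g D \<longleftrightarrow>
     (\<exists>c. \<forall>X\<in>vector_fields A. \<forall>Y\<in>vector_fields A. \<forall>p.
        ricci_tensor A D X Y p = c * apply_bilinear g X Y p)"


section \<open>Para-Sasakian manifolds\<close>

definition almost_paracontact_metric_manifold ::
  "('m::{t2_space, second_countable_topology}, 'e::euclidean_space) atlas \<Rightarrow> nat \<Rightarrow>
   'm endo_field \<Rightarrow> 'm vfield \<Rightarrow> 'm one_form \<Rightarrow> 'm bilinear_field \<Rightarrow> bool" where
  "almost_paracontact_metric_manifold (A :: ('m, 'e) atlas) n \<phi> \<zeta> \<eta> g \<longleftrightarrow>
     smooth_atlas A \<and> DIM('e) = 2 * n + 1 \<and>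
     smooth_endo_field A \<phi> \<and> \<zeta> \<in> vector_fields A \<and> smooth_one_form A \<eta> \<and>
     semi_riemannian_metric A g \<and>
     (\<forall>p. \<forall>v\<in>tangent_space A p. \<phi> p (\<phi> p v) = v - \<eta> p v *\<^sub>R \<zeta> p) \<and>
     (\<forall>p. \<eta> p (\<zeta> p) = 1) \<and>
     (\<forall>p. dim {v \<in> tangent_space A p. \<eta> p v = 0 \<and> \<phi> p v = v} = n) \<and>
     (\<forall>p. dim {v \<in> tangent_space A p. \<eta> p v = 0 \<and> \<phi> p v = - v} = n) \<and>
     (\<forall>p. \<forall>v\<in>tangent_space A p. \<forall>w\<in>tangent_space A p.
        g p (\<phi> p v) (\<phi> p w) = - g p v w + \<eta> p v * \<eta> p w)"

text \<open>The convention with the factor one half.\<close>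

definition exterior_derivative :: "'m one_form \<Rightarrow> 'm vfield \<Rightarrow> 'm vfield \<Rightarrow> 'm \<Rightarrow> real" where
  "exterior_derivative \<omega> X Y = (1/2) *\<^sub>R
     (lie_derivative_fun X (apply_form \<omega> Y) - lie_derivative_fun Y (apply_form \<omega> X)
       - apply_form \<omega> (lie_bracket X Y))"

definition paracontact_metric_manifold ::
  "('m::{t2_space, second_countable_topology}, 'e::euclidean_space) atlas \<Rightarrow> nat \<Rightarrow>
   'm endo_field \<Rightarrow> 'm vfield \<Rightarrow> 'm one_form \<Rightarrow> 'm bilinear_field \<Rightarrow> bool" where
  "paracontact_metric_manifold A n \<phi> \<zeta> \<eta> g \<longleftrightarrow>
     almost_paracontact_metric_manifold A n \<phi> \<zeta> \<eta> g \<and>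
     (\<forall>X\<in>vector_fields A. \<forall>Y\<in>vector_fields A.
        exterior_derivative \<eta> X Y = apply_bilinear g X (apply_endo \<phi> Y))"

definition nijenhuis_torsion :: "'m endo_field \<Rightarrow> 'm vfield \<Rightarrow> 'm vfield \<Rightarrow> 'm vfield" where
  "nijenhuis_torsion \<phi> X Y =
     apply_endo \<phi> (apply_endo \<phi> (lie_bracket X Y))
       + lie_bracket (apply_endo \<phi> X) (apply_endo \<phi> Y)
       - apply_endo \<phi> (lie_bracket (apply_endo \<phi> X) Y)
       - apply_endo \<phi> (lie_bracket X (apply_endo \<phi> Y))"

definition normal_structure ::
  "('m::{t2_space, second_countable_topology}, 'e::euclidean_space) atlas \<Rightarrow>
   'm endo_field \<Rightarrow> 'm vfield \<Rightarrow> 'm one_form \<Rightarrow> bool" where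
  "normal_structure A \<phi> \<zeta> \<eta> \<longleftrightarrow>
     (\<forall>X\<in>vector_fields A. \<forall>Y\<in>vector_fields A.
        nijenhuis_torsion \<phi> X Y - scale_field (2 *\<^sub>R exterior_derivative \<eta> X Y) \<zeta> = 0)"

definition para_sasakian_manifold ::
  "('m::{t2_space, second_countable_topology}, 'e::euclidean_space) atlas \<Rightarrow> nat \<Rightarrow>
   'm endo_field \<Rightarrow> 'm vfield \<Rightarrow> 'm one_form \<Rightarrow> 'm bilinear_field \<Rightarrow> bool" where
  "para_sasakian_manifold A n \<phi> \<zeta> \<eta> g \<longleftrightarrow>
     paracontact_metric_manifold A n \<phi> \<zeta> \<eta> g \<and> normal_structure A \<phi> \<zeta> \<eta>"


section \<open>Solitons\<close>

definition h_almost_ricci_yamabe_soliton ::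
  "('m::{t2_space, second_countable_topology}, 'e::euclidean_space) atlas \<Rightarrow>
   'm bilinear_field \<Rightarrow> 'm connection \<Rightarrow> 'm vfield \<Rightarrow>
   ('m \<Rightarrow> real) \<Rightarrow> ('m \<Rightarrow> real) \<Rightarrow> real \<Rightarrow> real \<Rightarrow> bool" where
  "h_almost_ricci_yamabe_soliton A g D V h l \<alpha> \<beta> \<longleftrightarrow>
     V \<in> vector_fields A \<and> h \<in> smooth_functions A \<and> l \<in> smooth_functions A \<and>
     (\<forall>X\<in>vector_fields A. \<forall>Y\<in>vector_fields A. \<forall>p.
        h p / 2 * lie_derivative_metric V g X Y p + \<alpha> * ricci_tensor A D X Y p
          + (l p - \<beta> / 2 * scalar_curvature A g D p) * apply_bilinear g X Y p = 0)"

definition proper_h_almost_ricci_yamabe_soliton ::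
  "('m::{t2_space, second_countable_topology}, 'e::euclidean_space) atlas \<Rightarrow>
   'm bilinear_field \<Rightarrow> 'm connection \<Rightarrow> 'm vfield \<Rightarrow>
   ('m \<Rightarrow> real) \<Rightarrow> ('m \<Rightarrow> real) \<Rightarrow> real \<Rightarrow> real \<Rightarrow> bool" where
  "proper_h_almost_ricci_yamabe_soliton A g D V h l \<alpha> \<beta> \<longleftrightarrow>
     h_almost_ricci_yamabe_soliton A g D V h l \<alpha> \<beta> \<and> \<alpha> \<noteq> 0 \<and> \<alpha> \<noteq> 1"

end

theory Submission
  imports Defs
begin

text \<open>Evaluating \<open>d\<eta>\<close> on \<open>\<zeta>\<close> shows that \<open>\<eta>\<close> is invariant under the flow of \<open>\<zeta>\<close>, hence so is
  \<open>d\<eta> = g(\<cdot>, \<phi>\<cdot>)\<close>; normality gives the invariance of \<open>\<phi>\<close>, and together they make \<open>\<zeta>\<close> a Killing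
  field. The soliton equation therefore reduces to \<open>S = f g\<close> for a function \<open>f\<close>. From
  \<open>\<nabla>\<zeta> = -\<phi>\<close> and the invariance of \<open>\<phi>\<close> one computes \<open>R(X, \<zeta>)\<zeta> = \<eta>(X)\<zeta> - X\<close>, so
  \<open>f = S(\<zeta>, \<zeta>) = -2n\<close> is constant. Bump functions are needed because the trace is taken over
  tangent vectors, each of which has to be extended to a global vector field.\<close>

section \<open>Differentiability classes\<close>

text \<open>Tangent vectors are abstract derivations, so a trace over a tangent space cannot be
  evaluated before its dimension is known. The upper bound \<open>2 * n + 1\<close> comes from the
  paracontact structure itself: \<open>\<phi>\<close> splits each tangent vector into a multiple of
  \<open>\<zeta>\<close> and two eigenvectors, and the eigenspaces have the prescribed dimension
  \<open>n\<close>. Coordinate fields supply the matching lower bound. Equality fixes the size of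
  every basis and also shows that every tangent vector is the value of a global field, which gives
  sense to \<open>field_through\<close>. The constant \<open>-2n\<close> is then
  \<open>1 - (2n + 1)\<close>: the trace of a rank-one map with image spanned by
  \<open>\<zeta>\<close>, minus the trace of the identity. In \<open>R(X, \<zeta>)\<zeta>\<close>
  only derivatives of \<open>\<zeta>\<close> and derivatives along \<open>\<zeta>\<close> occur.
  Torsion-freeness expresses the latter through brackets with \<open>\<zeta>\<close>, so neither the
  Koszul formula nor a general formula for \<open>\<nabla>\<phi>\<close> enters.\<close>

lemma C_k_on_SucD:
  assumes "C_k_on (Suc k) S f" "x \<in> S"
  shows "(f has_derivative frechet_derivative f (at x)) (at x)"
  using assms by (simp add: frechet_derivative_works)

lemma C_k_on_frechet_derivative:
  "C_k_on (Suc k) S f \<Longrightarrow> C_k_on k S (\<lambda>x. frechet_derivative f (at x) v)"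
  by simp

text \<open>Openness matters: the derivative is the unrestricted one, so agreement on a whole
  neighbourhood of each point is needed.\<close>

lemma C_k_on_cong:
  assumes "open S" "\<And>x. x \<in> S \<Longrightarrow> f x = g x" "C_k_on k S f"
  shows "C_k_on k S g"
  using assms(2,3)
proof (induction k arbitrary: f g)
  case 0
  then show ?case by (simp cong: continuous_on_cong)
next
  case (Suc k)
  have eq: "frechet_derivative f (at x) = frechet_derivative g (at x)" if "x \<in> S" for x
    using frechet_derivative_transform_within_open[of f x S g] Suc.prems assms(1) that by auto
  have "g differentiable (at x)" if "x \<in> S" for x
    using has_derivative_transform_within_open[OF C_k_on_SucD[OF Suc.prems(2) that] assms(1) that]
      Suc.prems(1) by (auto simp: differentiable_def)
  moreover have "C_k_on k S (\<lambda>x. frechet_derivative g (at x) v)" for v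
    by (rule Suc.IH[of "\<lambda>x. frechet_derivative f (at x) v"]) (use eq Suc.prems in auto)
  ultimately show ?case by simp
qed

text \<open>Derivatives are unique, so an explicit candidate \<open>f'\<close> may stand for
  \<open>frechet_derivative\<close>. The closure properties below become inductions on
  \<open>k\<close> that only have to supply the derivative formula.\<close>

lemma C_k_on_SucI:
  assumes "open S" "\<And>x. x \<in> S \<Longrightarrow> (f has_derivative f' x) (at x)"
    "\<And>v. C_k_on k S (\<lambda>x. f' x v)"
  shows "C_k_on (Suc k) S f"
proof -
  have "C_k_on k S (\<lambda>x. frechet_derivative f (at x) v)" for v
    by (rule C_k_on_cong[OF assms(1) _ assms(3)[of v]])
       (simp add: frechet_derivative_at[OF assms(2), symmetric])
  then show ?thesis using assms(2) by (auto simp: differentiable_def)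
qed

lemma C_k_on_Suc_imp: "C_k_on (Suc k) S f \<Longrightarrow> C_k_on k S f"
proof (induction k arbitrary: f)
  case 0
  then show ?case
    by (auto intro!: continuous_at_imp_continuous_on differentiable_imp_continuous_within)
next
  case (Suc k)
  then show ?case by (metis C_k_on.simps(2))
qed

lemma C_k_on_subset: "C_k_on k S f \<Longrightarrow> T \<subseteq> S \<Longrightarrow> C_k_on k T f"
  by (induction k arbitrary: f) (auto intro: continuous_on_subset)

lemma C_k_on_local:
  assumes "\<And>x. x \<in> S \<Longrightarrow> \<exists>T. open T \<and> x \<in> T \<and> C_k_on k T f"
  shows "C_k_on k S f"
  using assms
proof (induction k arbitrary: f)
  case 0
  have "isCont f x" if "x \<in> S" for x
    using 0[OF that] by (auto simp: continuous_on_eq_continuous_at)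
  then show ?case by (simp add: continuous_at_imp_continuous_on)
next
  case (Suc k)
  have "f differentiable (at x)" if "x \<in> S" for x
    using Suc.prems[OF that] by auto
  moreover have "C_k_on k S (\<lambda>x. frechet_derivative f (at x) v)" for v
    by (rule Suc.IH) (use Suc.prems in \<open>metis C_k_on.simps(2)\<close>)
  ultimately show ?case by simp
qed

lemma C_k_on_const: "open S \<Longrightarrow> C_k_on k S (\<lambda>x. c)"
proof (induction k arbitrary: c)
  case (Suc k)
  show ?case
    by (rule C_k_on_SucI[where f' = "\<lambda>_ _. 0"]) (use Suc in \<open>auto\<close>)
qed auto

lemma C_k_on_bounded_linear:
  assumes "bounded_linear h" "open S" "C_k_on k S f"
  shows "C_k_on k S (\<lambda>x. h (f x))"
  using assms(3)
proof (induction k arbitrary: f)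
  case 0
  then show ?case using assms(1) by (auto intro: bounded_linear.continuous_on)
next
  case (Suc k)
  show ?case
  proof (rule C_k_on_SucI[OF assms(2)])
    show "((\<lambda>x. h (f x)) has_derivative (\<lambda>v. h (frechet_derivative f (at x) v))) (at x)"
      if "x \<in> S" for x
      using bounded_linear.has_derivative[OF assms(1) C_k_on_SucD[OF Suc.prems that]] .
    show "C_k_on k S (\<lambda>x. h (frechet_derivative f (at x) v))" for v
      by (rule Suc.IH) (use Suc.prems in auto)
  qed
qed

lemma C_k_on_add:
  assumes "open S" "C_k_on k S f" "C_k_on k S g"
  shows "C_k_on k S (\<lambda>x. f x + g x)"
  using assms(2,3)
proof (induction k arbitrary: f g)
  case 0
  then show ?case by (auto intro: continuous_on_add)
next
  case (Suc k)
  show ?case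
  proof (rule C_k_on_SucI[OF assms(1)])
    show "((\<lambda>x. f x + g x) has_derivative
        (\<lambda>v. frechet_derivative f (at x) v + frechet_derivative g (at x) v)) (at x)"
      if "x \<in> S" for x
      using has_derivative_add C_k_on_SucD Suc.prems that by blast
    show "C_k_on k S (\<lambda>x. frechet_derivative f (at x) v + frechet_derivative g (at x) v)" for v
      by (rule Suc.IH) (use Suc.prems in auto)
  qed
qed

lemma C_k_on_sum:
  assumes "open S" "\<And>i. i \<in> I \<Longrightarrow> C_k_on k S (f i)"
  shows "C_k_on k S (\<lambda>x. \<Sum>i\<in>I. f i x)"
  using assms(2)
  by (induction I rule: infinite_finite_induct) (auto intro: C_k_on_const C_k_on_add assms(1))

lemma C_k_on_mult:
  fixes f g :: "'a::real_normed_vector \<Rightarrow> real"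
  assumes "open S" "C_k_on k S f" "C_k_on k S g"
  shows "C_k_on k S (\<lambda>x. f x * g x)"
  using assms(2,3)
proof (induction k arbitrary: f g)
  case 0
  then show ?case by (auto intro: continuous_on_mult)
next
  case (Suc k)
  show ?case
  proof (rule C_k_on_SucI[OF assms(1)])
    show "((\<lambda>x. f x * g x) has_derivative
        (\<lambda>v. f x * frechet_derivative g (at x) v + frechet_derivative f (at x) v * g x)) (at x)"
      if "x \<in> S" for x
      using has_derivative_mult C_k_on_SucD Suc.prems that by blast
    show "C_k_on k S (\<lambda>x. f x * frechet_derivative g (at x) v + frechet_derivative f (at x) v * g x)"
      for v
      by (intro C_k_on_add Suc.IH assms(1)) (use Suc.prems C_k_on_Suc_imp in auto)
  qed
qed

lemma C_k_on_id: "open S \<Longrightarrow> C_k_on k S (\<lambda>x. x)"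
proof (cases k)
  case (Suc m)
  assume "open S"
  then show ?thesis
    unfolding Suc by (intro C_k_on_SucI[where f' = "\<lambda>_ v. v"] C_k_on_const) auto
qed auto

text \<open>In the chain rule the direction \<open>?f x v\<close> varies with \<open>x\<close>,
  whereas the hypothesis on \<open>g\<close> speaks of fixed directions only. Expanding in the basis
  separates the two: the induction hypothesis applies to each partial derivative of
  \<open>g\<close>, and the components of \<open>?f x v\<close> are mere factors.\<close>

lemma C_k_on_compose:
  fixes f :: "'a::real_normed_vector \<Rightarrow> 'b::euclidean_space" and g :: "'b \<Rightarrow> real"
  assumes "open S" "open T" "f ` S \<subseteq> T" "C_k_on k S f" "C_k_on k T g"
  shows "C_k_on k S (\<lambda>x. g (f x))"
  using assms(4,5)
proof (induction k arbitrary: g)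
  case 0
  then show ?case using assms(3) by (auto intro: continuous_on_compose2)
next
  case (Suc k)
  let ?f = "\<lambda>x. frechet_derivative f (at x)" and ?g = "\<lambda>y. frechet_derivative g (at y)"
  show ?case
  proof (rule C_k_on_SucI[OF assms(1)])
    fix x assume x: "x \<in> S"
    have "(g has_derivative ?g (f x)) (at (f x))"
      by (rule C_k_on_SucD[OF Suc.prems(2)]) (use x assms(3) in auto)
    then have "((\<lambda>x. g (f x)) has_derivative (\<lambda>v. ?g (f x) (?f x v))) (at x)"
      using has_derivative_compose[OF C_k_on_SucD[OF Suc.prems(1) x]] by blast
    moreover have "(\<lambda>v. ?g (f x) (?f x v)) = (\<lambda>v. \<Sum>i\<in>Basis. ?g (f x) i * (?f x v \<bullet> i))"
    proof
      fix v
      let ?w = "?f x v"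
      have l: "linear (?g (f x))"
        using \<open>(g has_derivative ?g (f x)) (at (f x))\<close> has_derivative_linear by blast
      have "?g (f x) ?w = ?g (f x) (\<Sum>i\<in>Basis. (?w \<bullet> i) *\<^sub>R i)"
        by (simp add: euclidean_representation)
      also have "\<dots> = (\<Sum>i\<in>Basis. ?g (f x) i * (?w \<bullet> i))"
        by (simp add: linear_sum[OF l] linear_scale[OF l] mult.commute)
      finally show "?g (f x) ?w = (\<Sum>i\<in>Basis. ?g (f x) i * (?w \<bullet> i))" .
    qed
    ultimately show "((\<lambda>x. g (f x)) has_derivative
        (\<lambda>v. \<Sum>i\<in>Basis. ?g (f x) i * (?f x v \<bullet> i))) (at x)" by simp
  next
    fix v
    have "C_k_on k S (\<lambda>x. ?g (f x) i)" for i
      using C_k_on_Suc_imp[OF Suc.prems(1)] C_k_on_frechet_derivative[OF Suc.prems(2)]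
      by (rule Suc.IH[of "\<lambda>y. ?g y i"])
    moreover have "C_k_on k S (\<lambda>x. ?f x v \<bullet> i)" for i
      by (rule C_k_on_bounded_linear[OF bounded_linear_inner_left assms(1)]) (use Suc.prems in auto)
    ultimately show "C_k_on k S (\<lambda>x. \<Sum>i\<in>Basis. ?g (f x) i * (?f x v \<bullet> i))"
      by (intro C_k_on_sum C_k_on_mult assms(1)) auto
  qed
qed

lemma C_infinity_on_add:
  "open S \<Longrightarrow> C_infinity_on S f \<Longrightarrow> C_infinity_on S g \<Longrightarrow> C_infinity_on S (\<lambda>x. f x + g x)"
  by (simp add: C_infinity_on_def C_k_on_add)

lemma C_infinity_on_mult:
  fixes f g :: "'a::real_normed_vector \<Rightarrow> real"
  shows "open S \<Longrightarrow> C_infinity_on S f \<Longrightarrow> C_infinity_on S g \<Longrightarrow> C_infinity_on S (\<lambda>x. f x * g x)"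
  by (simp add: C_infinity_on_def C_k_on_mult)

lemma C_infinity_on_const: "open S \<Longrightarrow> C_infinity_on S (\<lambda>x. c)"
  by (simp add: C_infinity_on_def C_k_on_const)

lemma C_infinity_on_cong:
  "open S \<Longrightarrow> (\<And>x. x \<in> S \<Longrightarrow> f x = g x) \<Longrightarrow> C_infinity_on S f \<Longrightarrow> C_infinity_on S g"
  unfolding C_infinity_on_def using C_k_on_cong by blast

lemma C_infinity_on_subset: "C_infinity_on S f \<Longrightarrow> T \<subseteq> S \<Longrightarrow> C_infinity_on T f"
  unfolding C_infinity_on_def using C_k_on_subset by blast

lemma C_infinity_on_local:
  "(\<And>x. x \<in> S \<Longrightarrow> \<exists>T. open T \<and> x \<in> T \<and> C_infinity_on T f) \<Longrightarrow> C_infinity_on S f"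
  unfolding C_infinity_on_def by (intro allI C_k_on_local) meson

lemma C_infinity_on_compose:
  fixes f :: "'a::real_normed_vector \<Rightarrow> 'b::euclidean_space" and g :: "'b \<Rightarrow> real"
  assumes "open S" "open T" "f ` S \<subseteq> T" "C_infinity_on S f" "C_infinity_on T g"
  shows "C_infinity_on S (\<lambda>x. g (f x))"
  using assms C_k_on_compose unfolding C_infinity_on_def by blast

lemma C_infinity_on_has_derivative:
  "C_infinity_on S f \<Longrightarrow> x \<in> S \<Longrightarrow> (f has_derivative frechet_derivative f (at x)) (at x)"
  unfolding C_infinity_on_def using C_k_on_SucD by blast

lemma C_infinity_on_frechet_derivative:
  "C_infinity_on S f \<Longrightarrow> C_infinity_on S (\<lambda>x. frechet_derivative f (at x) v)"
  unfolding C_infinity_on_def using C_k_on_frechet_derivative by blast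

section \<open>Bump functions\<close>

text \<open>\<open>flat 0\<close> is the classical function that is smooth but not analytic at 0.
  The powers of \<open>inverse t\<close> make the family stable under differentiation up to linear
  combinations, so that one induction proves all members smooth.\<close>

definition flat :: "nat \<Rightarrow> real \<Rightarrow> real" where
  "flat k t = (if t > 0 then inverse t ^ k * exp (- inverse t) else 0)"

lemma flat_tendsto_0: "(flat k \<longlongrightarrow> 0) (at 0)"
proof -
  have "((\<lambda>t. t ^ k / exp t :: real) \<longlongrightarrow> 0) at_top"
    by (rule tendsto_power_div_exp_0)
  then have "((\<lambda>t. inverse t ^ k / exp (inverse t) :: real) \<longlongrightarrow> 0) (at_right 0)"
    by (rule filterlim_compose[OF _ filterlim_inverse_at_top_right])
  moreover have "eventually (\<lambda>t. inverse t ^ k / exp (inverse t) = flat k t) (at_right (0::real))"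
    by (auto simp: eventually_at_filter flat_def exp_minus divide_inverse)
  ultimately have "(flat k \<longlongrightarrow> 0) (at_right 0)"
    by (rule Lim_transform_eventually)
  moreover have "(flat k \<longlongrightarrow> 0) (at_left 0)"
    by (rule tendsto_eventually) (auto simp: eventually_at_filter flat_def)
  ultimately show ?thesis by (simp add: filterlim_split_at)
qed

lemma flat_has_derivative:
  "(flat k has_field_derivative flat (k + 2) t - real k * flat (k + 1) t) (at t)"
proof -
  consider "t > 0" | "t < 0" | "t = 0" by linarith
  then show ?thesis
  proof cases
    case 1
    have "((\<lambda>t. inverse t ^ k * exp (- inverse t)) has_field_derivative
        (real k * inverse t ^ (k - 1) * (- (inverse t)\<^sup>2)) * exp (- inverse t)
          + inverse t ^ k * (exp (- inverse t) * (inverse t)\<^sup>2)) (at t)"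
      using 1 by (auto intro!: derivative_eq_intros simp: power2_eq_square)
    \<comment> \<open>The exponent \<open>k - 1\<close> is truncated at \<open>k = 0\<close>, where
      the factor \<open>real k\<close> vanishes; hence the case distinction.\<close>
    also have "(real k * inverse t ^ (k - 1) * (- (inverse t)\<^sup>2)) * exp (- inverse t)
          + inverse t ^ k * (exp (- inverse t) * (inverse t)\<^sup>2)
        = flat (k + 2) t - real k * flat (k + 1) t"
      using 1 by (cases k) (simp_all add: flat_def power2_eq_square algebra_simps)
    finally have "((\<lambda>t. inverse t ^ k * exp (- inverse t)) has_field_derivative
        flat (k + 2) t - real k * flat (k + 1) t) (at t)" .
    then show ?thesis
      by (rule has_field_derivative_transform_within_open[where S = "{0<..}"])
         (use 1 in \<open>auto simp: flat_def\<close>)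
  next
    case 2
    have "((\<lambda>_. 0) has_field_derivative flat (k + 2) t - real k * flat (k + 1) t) (at t)"
      using 2 by (simp add: flat_def)
    then show ?thesis
      by (rule has_field_derivative_transform_within_open[where S = "{..<0}"])
         (use 2 in \<open>auto simp: flat_def\<close>)
  next
    case 3
    \<comment> \<open>At 0 the difference quotient of one member is the next member, whose limit is
      already known to be 0.\<close>
    have "(\<lambda>y. (flat k y - flat k 0) / (y - 0)) = flat (k + 1)"
      by (simp add: fun_eq_iff flat_def divide_inverse)
    then show ?thesis
      unfolding 3 has_field_derivative_iff using flat_tendsto_0[of "k + 1"]
      by (simp add: flat_def[of _ 0])
  qed
qed

lemma C_k_on_flat: "C_k_on m UNIV (flat k)"
proof (induction m arbitrary: k)
  case 0
  show ?case
    using flat_has_derivative by (auto intro!: continuous_at_imp_continuous_on DERIV_isCont)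
next
  case (Suc m)
  have "C_k_on m UNIV (\<lambda>t. (flat (k + 2) t + (- real k) * flat (k + 1) t) * v)" for v
    by (intro C_k_on_mult C_k_on_add C_k_on_const Suc.IH) auto
  then show ?case
    using flat_has_derivative[of k]
    by (intro C_k_on_SucI[where f' = "\<lambda>t v. (flat (k + 2) t + (- real k) * flat (k + 1) t) * v"])
       (auto simp: has_field_derivative_def)
qed

lemma bump_function:
  fixes x\<^sub>0 :: "'e::euclidean_space"
  assumes "r > 0"
  obtains b :: "'e \<Rightarrow> real"
  where "C_infinity_on UNIV b" "b x\<^sub>0 \<noteq> 0" "\<And>x. x \<notin> cball x\<^sub>0 r \<Longrightarrow> b x = 0"
proof
  \<comment> \<open>Positive exactly on the open ball of radius \<open>r\<close>. The squared norm
    is written in coordinates, and the difference as a sum with factor \<open>- 1\<close>, so that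
    the closure rules for sums and products apply.\<close>
  let ?q = "\<lambda>x. r\<^sup>2 + (- 1) * (\<Sum>i\<in>Basis. ((x - x\<^sub>0) \<bullet> i) * ((x - x\<^sub>0) \<bullet> i))"
  let ?b = "\<lambda>x. flat 0 (?q x)"
  have q: "?q x = r\<^sup>2 - (dist x x\<^sub>0)\<^sup>2" for x
    unfolding dist_norm power2_norm_eq_inner euclidean_inner[symmetric] by simp
  have "C_k_on k UNIV (\<lambda>x. x + (- x\<^sub>0))" for k
    by (intro C_k_on_add C_k_on_id C_k_on_const) auto
  then have "C_k_on k UNIV (\<lambda>x. (x - x\<^sub>0) \<bullet> i)" for k i
    by (auto intro!: C_k_on_bounded_linear[OF bounded_linear_inner_left])
  then have "C_k_on k UNIV ?q" for k
    by (intro C_k_on_add C_k_on_mult C_k_on_sum C_k_on_const) auto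
  then have "C_k_on k UNIV ?b" for k
    by (rule C_k_on_compose[OF open_UNIV open_UNIV subset_UNIV _ C_k_on_flat])
  then show "C_infinity_on UNIV ?b" by (simp add: C_infinity_on_def)
  show "?b x\<^sub>0 \<noteq> 0" using assms by (simp add: flat_def)
  show "?b x = 0" if "x \<notin> cball x\<^sub>0 r" for x
  proof -
    have "r < dist x x\<^sub>0" using that by (simp add: dist_commute)
    then have "r\<^sup>2 < (dist x x\<^sub>0)\<^sup>2" using assms by (intro power_strict_mono) auto
    then show ?thesis unfolding q by (simp add: flat_def)
  qed
qed

section \<open>The algebra of smooth functions\<close>

locale smooth_manifold =
  fixes A :: "('m::{t2_space, second_countable_topology}, 'e::euclidean_space) atlas"
  assumes atlas: "smooth_atlas A"
begin

lemma chart: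
  assumes "(U, \<psi>) \<in> A"
  shows open_chart_domain: "open U" and open_chart_image: "open (\<psi> ` U)"
    and inj_on_chart: "inj_on \<psi> U"
    and homeomorphism_chart: "homeomorphism U (\<psi> ` U) \<psi> (inv_into U \<psi>)"
  using atlas assms by (auto simp: smooth_atlas_def)

lemma chart_around: obtains U \<psi> where "(U, \<psi>) \<in> A" "p \<in> U"
proof -
  have "p \<in> (\<Union>(U, \<psi>)\<in>A. U)" using atlas by (simp add: smooth_atlas_def)
  then show ?thesis using that by blast
qed

lemma transition_smooth:
  "(U, \<psi>) \<in> A \<Longrightarrow> (V, \<theta>) \<in> A \<Longrightarrow> C_infinity_on (\<psi> ` (U \<inter> V)) (\<lambda>x. \<theta> (inv_into U \<psi> x))"
  using atlas by (fastforce simp: smooth_atlas_def comp_def)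

lemma open_chart_image_of_open:
  assumes "(U, \<psi>) \<in> A" "open W" "W \<subseteq> U"
  shows "open (\<psi> ` W)"
proof -
  have "openin (top_of_set (\<psi> ` U)) (\<psi> ` W)"
    using homeomorphism_imp_open_map[OF homeomorphism_chart[OF assms(1)]] assms(2,3)
    by (simp add: openin_open_eq open_chart_domain[OF assms(1)])
  then show ?thesis using open_chart_image[OF assms(1)] openin_open_trans by blast
qed

lemma smooth_functions_chart:
  "f \<in> smooth_functions A \<Longrightarrow> (U, \<psi>) \<in> A \<Longrightarrow> C_infinity_on (\<psi> ` U) (f \<circ> inv_into U \<psi>)"
  by (auto simp: smooth_functions_def)

lemma smooth_functionsI:
  "(\<And>U \<psi>. (U, \<psi>) \<in> A \<Longrightarrow> C_infinity_on (\<psi> ` U) (\<lambda>x. f (inv_into U \<psi> x))) \<Longrightarrow> f \<in> smooth_functions A"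
  by (auto simp: smooth_functions_def comp_def)

lemma smooth_functions_const: "(\<lambda>_. c) \<in> smooth_functions A"
  by (intro smooth_functionsI C_infinity_on_const open_chart_image)

lemma smooth_functions_zero: "0 \<in> smooth_functions A"
  using smooth_functions_const[of 0] by (simp add: zero_fun_def)

lemma smooth_functions_add:
  assumes "f \<in> smooth_functions A" "g \<in> smooth_functions A"
  shows "f + g \<in> smooth_functions A"
  unfolding plus_fun_def
  using smooth_functions_chart[OF assms(1)] smooth_functions_chart[OF assms(2)]
  by (intro smooth_functionsI C_infinity_on_add open_chart_image) (simp_all add: comp_def)

lemma smooth_functions_mult:
  assumes "f \<in> smooth_functions A" "g \<in> smooth_functions A"
  shows "f * g \<in> smooth_functions A"
  unfolding times_fun_def
  using smooth_functions_chart[OF assms(1)] smooth_functions_chart[OF assms(2)]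
  by (intro smooth_functionsI C_infinity_on_mult open_chart_image) (simp_all add: comp_def)

lemma smooth_functions_scaleR: "f \<in> smooth_functions A \<Longrightarrow> c *\<^sub>R f \<in> smooth_functions A"
  using smooth_functions_mult[OF smooth_functions_const[of c]]
  by (simp add: times_fun_def scaleR_fun_def)

lemma smooth_functions_diff:
  "f \<in> smooth_functions A \<Longrightarrow> g \<in> smooth_functions A \<Longrightarrow> f - g \<in> smooth_functions A"
  using smooth_functions_add[OF _ smooth_functions_scaleR[of g "-1"], of f] by simp

text \<open>Near a point of \<open>U\<close> the extension is \<open>G\<close> composed with a chart
  transition. A point outside \<open>U\<close> has a neighbourhood that misses the preimage of
  \<open>K\<close>, because this preimage is compact and therefore closed in a Hausdorff space;
  there the extension is 0.\<close>

lemma smooth_functions_extend: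
  assumes U: "(U, \<psi>) \<in> A" and K: "compact K" "K \<subseteq> \<psi> ` U"
    and G: "C_infinity_on (\<psi> ` U) G" and G0: "\<And>x. x \<in> \<psi> ` U \<Longrightarrow> x \<notin> K \<Longrightarrow> G x = 0"
  shows "(\<lambda>q. if q \<in> U then G (\<psi> q) else 0) \<in> smooth_functions A"
proof (rule smooth_functionsI, rule C_infinity_on_local)
  fix V \<theta> y assume V: "(V, \<theta>) \<in> A" and y: "y \<in> \<theta> ` V"
  let ?q = "inv_into V \<theta>"
  let ?F = "\<lambda>x. if ?q x \<in> U then G (\<psi> (?q x)) else 0"
  have q: "?q (\<theta> v) = v" if "v \<in> V" for v
    using inj_on_chart[OF V] that by (rule inv_into_f_f)
  have y_eq: "\<theta> (?q y) = y" and y_in: "?q y \<in> V"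
    using y by (auto simp: f_inv_into_f inv_into_into)
  show "\<exists>T. open T \<and> y \<in> T \<and> C_infinity_on T ?F"
  proof (cases "?q y \<in> U")
    case True
    let ?T = "\<theta> ` (V \<inter> U)"
    have T: "open ?T"
      by (rule open_chart_image_of_open[OF V])
         (use open_chart_domain[OF U] open_chart_domain[OF V] in auto)
    have "C_infinity_on ?T (\<lambda>x. G (\<psi> (?q x)))"
      by (rule C_infinity_on_compose[OF T open_chart_image[OF U] _ transition_smooth[OF V U] G])
         (auto simp: q)
    then have "C_infinity_on ?T ?F"
      by (rule C_infinity_on_cong[OF T, rotated]) (auto simp: q)
    moreover have "y \<in> ?T" using y_eq y_in True by force
    ultimately show ?thesis using T by blast
  next
    case False
    let ?L = "inv_into U \<psi> ` K"
    let ?T = "\<theta> ` (V - ?L)"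
    have "compact ?L"
      using K homeomorphism_chart[OF U]
      by (intro compact_continuous_image) (auto simp: homeomorphism_def intro: continuous_on_subset)
    then have "closed ?L" by (rule compact_imp_closed)
    have T: "open ?T"
      by (rule open_chart_image_of_open[OF V])
         (use open_chart_domain[OF V] \<open>closed ?L\<close> in auto)
    have "?L \<subseteq> U" using K(2) by (auto intro: inv_into_into)
    then have "y \<in> ?T" using False y_eq y_in by force
    moreover have "C_infinity_on ?T ?F"
    proof (rule C_infinity_on_cong[OF T _ C_infinity_on_const[OF T]])
      fix x assume "x \<in> ?T"
      then obtain v where v: "v \<in> V" "v \<notin> ?L" "x = \<theta> v" by blast
      have "G (\<psi> v) = 0" if "v \<in> U"
      proof (rule G0)
        show "\<psi> v \<notin> K"
        proof
          assume "\<psi> v \<in> K"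
          then have "inv_into U \<psi> (\<psi> v) \<in> ?L" by blast
          then show False using v(2) inv_into_f_f[OF inj_on_chart[OF U] that] by simp
        qed
      qed (use that in auto)
      then show "0 = ?F x" using v q by auto
    qed
    ultimately show ?thesis using T by blast
  qed
qed

section \<open>Vector fields\<close>

lemma tangent_add:
  "v \<in> tangent_space A p \<Longrightarrow> f \<in> smooth_functions A \<Longrightarrow> g \<in> smooth_functions A \<Longrightarrow>
    v (f + g) = v f + v g"
  by (auto simp: tangent_space_def)

lemma tangent_mult:
  "v \<in> tangent_space A p \<Longrightarrow> f \<in> smooth_functions A \<Longrightarrow> g \<in> smooth_functions A \<Longrightarrow>
    v (f * g) = f p * v g + g p * v f"
  by (auto simp: tangent_space_def)

lemma tangent_scaleR:
  "v \<in> tangent_space A p \<Longrightarrow> f \<in> smooth_functions A \<Longrightarrow> v (c *\<^sub>R f) = c * v f"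
  by (auto simp: tangent_space_def)

lemma tangent_nonsmooth: "v \<in> tangent_space A p \<Longrightarrow> f \<notin> smooth_functions A \<Longrightarrow> v f = 0"
  by (auto simp: tangent_space_def)

lemma tangent_diff:
  assumes "v \<in> tangent_space A p" "f \<in> smooth_functions A" "g \<in> smooth_functions A"
  shows "v (f - g) = v f - v g"
  using tangent_add[OF assms(1,2) smooth_functions_scaleR[OF assms(3), of "-1"]]
    tangent_scaleR[OF assms(1,3), of "-1"] by simp

lemma tangent_zero: "v \<in> tangent_space A p \<Longrightarrow> v 0 = 0"
  using tangent_scaleR[OF _ smooth_functions_zero, of v p 0] by simp

lemma tangent_const:
  assumes "v \<in> tangent_space A p"
  shows "v (\<lambda>_. c) = 0"
proof -
  have "v ((\<lambda>_. 1) * (\<lambda>_. 1)) = v (\<lambda>_. 1) + v (\<lambda>_. 1)"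
    using tangent_mult[OF assms smooth_functions_const smooth_functions_const] by simp
  then have "v (\<lambda>_. 1) = 0" by (simp add: times_fun_def)
  then show ?thesis
    using tangent_scaleR[OF assms smooth_functions_const[of 1], of c] by (simp add: scaleR_fun_def)
qed

lemma subspace_tangent_space: "subspace (tangent_space A p)"
  by (auto simp: subspace_def tangent_space_def scaleR_fun_def algebra_simps)

lemma vector_field_tangent: "X \<in> vector_fields A \<Longrightarrow> X p \<in> tangent_space A p"
  by (simp add: vector_fields_def)

lemma vector_field_smooth:
  "X \<in> vector_fields A \<Longrightarrow> f \<in> smooth_functions A \<Longrightarrow> lie_derivative_fun X f \<in> smooth_functions A"
  by (simp add: vector_fields_def)

lemma vector_fields_add:
  assumes "X \<in> vector_fields A" "Y \<in> vector_fields A"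
  shows "X + Y \<in> vector_fields A"
proof -
  have "lie_derivative_fun (X + Y) f = lie_derivative_fun X f + lie_derivative_fun Y f" for f
    by (simp add: lie_derivative_fun_def fun_eq_iff)
  then show ?thesis using assms
    by (auto simp: vector_fields_def intro!: smooth_functions_add subspace_add[OF subspace_tangent_space])
qed

lemma vector_fields_scale:
  assumes "h \<in> smooth_functions A" "X \<in> vector_fields A"
  shows "scale_field h X \<in> vector_fields A"
proof -
  have "lie_derivative_fun (scale_field h X) f = h * lie_derivative_fun X f" for f
    by (simp add: lie_derivative_fun_def scale_field_def scaleR_fun_def fun_eq_iff)
  then show ?thesis using assms
    by (auto simp: vector_fields_def scale_field_def
        intro!: smooth_functions_mult subspace_scale[OF subspace_tangent_space])
qed

lemma vector_fields_scaleR: "X \<in> vector_fields A \<Longrightarrow> c *\<^sub>R X \<in> vector_fields A"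
  using vector_fields_scale[OF smooth_functions_const[of c]]
  by (simp add: scale_field_def scaleR_fun_def)

lemma vector_fields_uminus: "X \<in> vector_fields A \<Longrightarrow> - X \<in> vector_fields A"
  using vector_fields_scaleR[of X "-1"] by simp

lemma vector_fields_diff:
  "X \<in> vector_fields A \<Longrightarrow> Y \<in> vector_fields A \<Longrightarrow> X - Y \<in> vector_fields A"
  using vector_fields_add[OF _ vector_fields_uminus, of X Y] by simp

lemma vector_fields_zero: "0 \<in> vector_fields A"
proof -
  have "lie_derivative_fun 0 f = 0" for f :: "'m \<Rightarrow> real"
    by (simp add: lie_derivative_fun_def fun_eq_iff)
  then show ?thesis
    by (simp add: vector_fields_def smooth_functions_zero subspace_0[OF subspace_tangent_space])
qed

lemma lie_derivative_add:
  "X \<in> vector_fields A \<Longrightarrow> f \<in> smooth_functions A \<Longrightarrow> g \<in> smooth_functions A \<Longrightarrow>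
    lie_derivative_fun X (f + g) = lie_derivative_fun X f + lie_derivative_fun X g"
  by (simp add: lie_derivative_fun_def fun_eq_iff tangent_add[OF vector_field_tangent])

lemma lie_derivative_diff:
  "X \<in> vector_fields A \<Longrightarrow> f \<in> smooth_functions A \<Longrightarrow> g \<in> smooth_functions A \<Longrightarrow>
    lie_derivative_fun X (f - g) = lie_derivative_fun X f - lie_derivative_fun X g"
  by (simp add: lie_derivative_fun_def fun_eq_iff tangent_diff[OF vector_field_tangent])

lemma lie_derivative_mult:
  "X \<in> vector_fields A \<Longrightarrow> f \<in> smooth_functions A \<Longrightarrow> g \<in> smooth_functions A \<Longrightarrow>
    lie_derivative_fun X (f * g) = f * lie_derivative_fun X g + g * lie_derivative_fun X f"
  by (simp add: lie_derivative_fun_def fun_eq_iff tangent_mult[OF vector_field_tangent])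

lemma lie_derivative_scaleR:
  "X \<in> vector_fields A \<Longrightarrow> f \<in> smooth_functions A \<Longrightarrow>
    lie_derivative_fun X (c *\<^sub>R f) = c *\<^sub>R lie_derivative_fun X f"
  by (rule ext)
     (simp add: lie_derivative_fun_def tangent_scaleR[OF vector_field_tangent]
       scaleR_fun_def[of c "\<lambda>p. X p f"])

lemma lie_derivative_const: "X \<in> vector_fields A \<Longrightarrow> lie_derivative_fun X (\<lambda>_. c) = 0"
  by (simp add: lie_derivative_fun_def fun_eq_iff tangent_const[OF vector_field_tangent])

lemma lie_derivative_bracket:
  "lie_derivative_fun (lie_bracket X Y) f =
    lie_derivative_fun X (lie_derivative_fun Y f) - lie_derivative_fun Y (lie_derivative_fun X f)"
  by (simp add: lie_derivative_fun_def lie_bracket_def fun_eq_iff)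

lemma vector_field_nonsmooth:
  "X \<in> vector_fields A \<Longrightarrow> f \<notin> smooth_functions A \<Longrightarrow> lie_derivative_fun X f = 0"
  by (simp add: lie_derivative_fun_def fun_eq_iff tangent_nonsmooth[OF vector_field_tangent])

lemma vector_fields_bracket:
  assumes X: "X \<in> vector_fields A" and Y: "Y \<in> vector_fields A"
  shows "lie_bracket X Y \<in> vector_fields A"
proof -
  let ?B = "\<lambda>f. lie_derivative_fun (lie_bracket X Y) f"
  have B: "lie_bracket X Y p f = ?B f p" for p f by (simp add: lie_derivative_fun_def)
  note smooth = vector_field_smooth[OF X] vector_field_smooth[OF Y]
  have "?B (f + g) = ?B f + ?B g" "?B (f * g) = f * ?B g + g * ?B f"
    if "f \<in> smooth_functions A" "g \<in> smooth_functions A" for f g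
    using that
    by (simp_all add: lie_derivative_bracket lie_derivative_add[OF X] lie_derivative_add[OF Y]
        lie_derivative_mult[OF X] lie_derivative_mult[OF Y] smooth smooth_functions_mult algebra_simps)
  moreover have "?B (c *\<^sub>R f) = c *\<^sub>R ?B f" if "f \<in> smooth_functions A" for c f
    using that
    by (simp add: lie_derivative_bracket lie_derivative_scaleR[OF X] lie_derivative_scaleR[OF Y]
        smooth scaleR_diff_right)
  \<comment> \<open>The inner derivative of a non-smooth function is the zero function, which is
    smooth and constant, so the outer derivative vanishes as well.\<close>
  moreover have "?B f = 0" if "f \<notin> smooth_functions A" for f
    using that lie_derivative_const[OF X, of 0] lie_derivative_const[OF Y, of 0]
    by (simp add: lie_derivative_bracket vector_field_nonsmooth[OF X] vector_field_nonsmooth[OF Y]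
        zero_fun_def)
  ultimately have "lie_bracket X Y p \<in> tangent_space A p" for p
    by (simp add: tangent_space_def B scaleR_fun_def)
  moreover have "?B f \<in> smooth_functions A" if "f \<in> smooth_functions A" for f
    using that by (simp add: lie_derivative_bracket smooth smooth_functions_diff)
  ultimately show ?thesis by (simp add: vector_fields_def)
qed

end

section \<open>Independent coordinate fields and the extension of tangent vectors\<close>

text \<open>Evaluating a linear relation at \<open>y j\<close> isolates its j-th coefficient. The
  diagonal value \<open>c\<close> is left free because cut-off coordinates pair with cut-off fields
  to a value other than 1.\<close>

lemma independent_dual_family:
  fixes v :: "'i \<Rightarrow> ('f \<Rightarrow> real)"
  assumes "finite I" "c \<noteq> 0" and vy: "\<And>i j. i \<in> I \<Longrightarrow> j \<in> I \<Longrightarrow> v i (y j) = (if i = j then c else 0)"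
  shows "inj_on v I" "independent (v ` I)"
proof -
  show inj: "inj_on v I"
  proof (rule inj_onI, rule ccontr)
    fix i j assume "i \<in> I" "j \<in> I" "v i = v j" "i \<noteq> j"
    then show False using vy[of i j] vy[of j j] \<open>c \<noteq> 0\<close> by simp
  qed
  show "independent (v ` I)"
  proof (rule real_vector.independent_if_scalars_zero)
    fix a x assume sum0: "(\<Sum>w\<in>v ` I. a w *\<^sub>R w) = 0" and "x \<in> v ` I"
    then obtain j where j: "j \<in> I" "x = v j" by blast
    have app: "(\<Sum>i\<in>J. F i) f = (\<Sum>i\<in>J. F i f)" for J and F :: "'i \<Rightarrow> 'f \<Rightarrow> real" and f
      by (induction J rule: infinite_finite_induct) auto
    have "0 = (\<Sum>i\<in>I. a (v i) *\<^sub>R v i) (y j)"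
      using sum0 by (simp add: sum.reindex[OF inj])
    also have "\<dots> = (\<Sum>i\<in>I. a (v i) * (if i = j then c else 0))"
      unfolding app by (rule sum.cong) (simp_all add: scaleR_fun_def vy[OF _ j(1)])
    also have "\<dots> = a x * c"
      using \<open>finite I\<close> j by (simp add: if_distrib[of "(*) _"] cong: if_cong)
    finally show "a x = 0" using \<open>c \<noteq> 0\<close> by simp
  qed (use \<open>finite I\<close> in simp)
qed

lemma frechet_derivative_eqI:
  "(f has_derivative F) (at x) \<Longrightarrow> frechet_derivative f (at x) h = F h"
  by (metis frechet_derivative_at)

context smooth_manifold
begin

lemma subspace_vector_field_values: "subspace {X p | X. X \<in> vector_fields A}"
  unfolding subspace_def
proof (intro conjI ballI allI)
  show "0 \<in> {X p | X. X \<in> vector_fields A}"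
    using vector_fields_zero by (auto intro!: exI[of _ 0])
next
  fix x y assume "x \<in> {X p | X. X \<in> vector_fields A}" "y \<in> {X p | X. X \<in> vector_fields A}"
  then obtain X Y where "x = X p" "y = Y p" "X \<in> vector_fields A" "Y \<in> vector_fields A" by blast
  then show "x + y \<in> {X p | X. X \<in> vector_fields A}"
    using vector_fields_add[of X Y] by (auto intro!: exI[of _ "X + Y"])
next
  fix c x assume "x \<in> {X p | X. X \<in> vector_fields A}"
  then obtain X where X: "x = X p" "X \<in> vector_fields A" by blast
  have "c *\<^sub>R X p = (c *\<^sub>R X) p" by (simp only: scaleR_fun_def[of c X])
  then show "c *\<^sub>R x \<in> {X p | X. X \<in> vector_fields A}"
    using X vector_fields_scaleR[of X c] by blast
qed

text \<open>The fields are the coordinate fields of a chart multiplied by a bump function \<open>b\<close>, and they are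
  tested on the coordinates centred at \<open>p\<close> multiplied by \<open>b\<close>. As the latter vanish at \<open>p\<close>, no
  derivative of \<open>b\<close> enters.\<close>

lemma coordinate_fields:
  obtains X :: "'e \<Rightarrow> 'm vfield"
  where "\<And>i. X i \<in> vector_fields A" "inj_on (\<lambda>i. X i p) Basis" "independent ((\<lambda>i. X i p) ` Basis)"
proof -
  obtain U \<psi> where U: "(U, \<psi>) \<in> A" "p \<in> U" by (rule chart_around)
  let ?O = "\<psi> ` U" and ?q = "inv_into U \<psi>" and ?x = "\<psi> p"
  have O: "open ?O" "?x \<in> ?O" using open_chart_image[OF U(1)] U(2) by auto
  have q: "?q (\<psi> u) = u" if "u \<in> U" for u
    using inj_on_chart[OF U(1)] that by (rule inv_into_f_f)
  obtain r where r: "r > 0" "cball ?x r \<subseteq> ?O" using O open_contains_cball by blast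
  obtain b :: "'e \<Rightarrow> real" where b: "C_infinity_on UNIV b" "b ?x \<noteq> 0"
    and b0: "\<And>x. x \<notin> cball ?x r \<Longrightarrow> b x = 0"
    using bump_function[OF r(1)] by metis
  have bO: "C_infinity_on ?O b" using b(1) by (rule C_infinity_on_subset) simp
  define cutoff where "cutoff G = (\<lambda>u. if u \<in> U then b (\<psi> u) * G (\<psi> u) else 0)" for G
  have cutoff: "cutoff G \<in> smooth_functions A" if "C_infinity_on ?O G" for G
    unfolding cutoff_def
    by (rule smooth_functions_extend[OF U(1) compact_cball r(2)])
       (use C_infinity_on_mult[OF O(1) bO that] b0 in auto)
  have diff: "((f \<circ> ?q) has_derivative frechet_derivative (f \<circ> ?q) (at (\<psi> u))) (at (\<psi> u))"
    if "f \<in> smooth_functions A" "u \<in> U" for f u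
    by (rule C_infinity_on_has_derivative[OF smooth_functions_chart[OF that(1) U(1)]])
       (use that(2) in simp)
  define X :: "'e \<Rightarrow> 'm vfield" where "X i = (\<lambda>u f. if f \<in> smooth_functions A \<and> u \<in> U
      then b (\<psi> u) * frechet_derivative (f \<circ> ?q) (at (\<psi> u)) i else 0)" for i
  have "X i u \<in> tangent_space A u" for i u
  proof (cases "u \<in> U")
    case True
    have "X i u (f + g) = X i u f + X i u g" "X i u (f * g) = f u * X i u g + g u * X i u f"
      if fg: "f \<in> smooth_functions A" "g \<in> smooth_functions A" for f g
    proof -
      let ?Df = "frechet_derivative (f \<circ> ?q) (at (\<psi> u))"
        and ?Dg = "frechet_derivative (g \<circ> ?q) (at (\<psi> u))"
      have "(((f + g) \<circ> ?q) has_derivative (\<lambda>h. ?Df h + ?Dg h)) (at (\<psi> u))"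
        using has_derivative_add[OF diff[OF fg(1) True] diff[OF fg(2) True]] by (simp add: comp_def)
      from frechet_derivative_eqI[OF this, of i]
      show "X i u (f + g) = X i u f + X i u g"
        using fg True by (simp add: X_def smooth_functions_add distrib_left)
      have "(((f * g) \<circ> ?q) has_derivative (\<lambda>h. f u * ?Dg h + ?Df h * g u)) (at (\<psi> u))"
        using has_derivative_mult[OF diff[OF fg(1) True] diff[OF fg(2) True]] q[OF True]
        by (simp add: comp_def)
      from frechet_derivative_eqI[OF this, of i]
      show "X i u (f * g) = f u * X i u g + g u * X i u f"
        using fg True by (simp add: X_def smooth_functions_mult algebra_simps)
    qed
    moreover have "X i u (c *\<^sub>R f) = c * X i u f" if f: "f \<in> smooth_functions A" for c f
    proof -
      let ?Df = "frechet_derivative (f \<circ> ?q) (at (\<psi> u))"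
      have "((c *\<^sub>R f \<circ> ?q) has_derivative (\<lambda>h. c * ?Df h)) (at (\<psi> u))"
        using has_derivative_scaleR_right[OF diff[OF f True], of c]
        by (simp add: comp_def scaleR_fun_def)
      from frechet_derivative_eqI[OF this, of i]
      show ?thesis using f True by (simp add: X_def smooth_functions_scaleR)
    qed
    ultimately show ?thesis by (simp add: tangent_space_def) (simp add: X_def)
  next
    case False
    then have "X i u = 0" by (simp add: X_def fun_eq_iff)
    then show ?thesis by (simp add: subspace_0[OF subspace_tangent_space])
  qed
  moreover have "lie_derivative_fun (X i) f \<in> smooth_functions A" if f: "f \<in> smooth_functions A" for i f
  proof -
    have "lie_derivative_fun (X i) f = cutoff (\<lambda>x. frechet_derivative (f \<circ> ?q) (at x) i)"
      using f by (auto simp: lie_derivative_fun_def X_def cutoff_def fun_eq_iff)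
    then show ?thesis
      by (simp add: cutoff C_infinity_on_frechet_derivative[OF smooth_functions_chart[OF f U(1)]])
  qed
  ultimately have X: "X i \<in> vector_fields A" for i by (simp add: vector_fields_def)
  define y where "y j = cutoff (\<lambda>x. (x - ?x) \<bullet> j)" for j
  have "C_k_on k ?O (\<lambda>x. (x + (- ?x)) \<bullet> j)" for k j
    by (intro C_k_on_bounded_linear[OF bounded_linear_inner_left] C_k_on_add C_k_on_id C_k_on_const O)
  then have y: "y j \<in> smooth_functions A" for j
    unfolding y_def by (intro cutoff) (simp add: C_infinity_on_def)
  \<comment> \<open>One factor \<open>b ?x\<close> comes from the field and one from the test
    function, hence the square.\<close>
  have Xy: "X i p (y j) = (if i = j then (b ?x)\<^sup>2 else 0)" if "i \<in> Basis" "j \<in> Basis" for i j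
  proof -
    let ?Db = "frechet_derivative b (at ?x)"
    have "((\<lambda>x. b x * ((x - ?x) \<bullet> j)) has_derivative
        (\<lambda>h. b ?x * (h \<bullet> j) + ?Db h * ((?x - ?x) \<bullet> j))) (at ?x)"
      by (intro has_derivative_mult C_infinity_on_has_derivative[OF b(1)])
         (auto intro!: derivative_eq_intros)
    then have "((\<lambda>x. b x * ((x - ?x) \<bullet> j)) has_derivative (\<lambda>h. b ?x * (h \<bullet> j))) (at ?x)"
      by simp
    then have "((y j \<circ> ?q) has_derivative (\<lambda>h. b ?x * (h \<bullet> j))) (at ?x)"
      by (rule has_derivative_transform_within_open[OF _ O]) (auto simp: y_def cutoff_def q)
    from frechet_derivative_eqI[OF this, of i] show ?thesis
      using that U(2) y[of j] by (simp add: X_def inner_Basis power2_eq_square)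
  qed
  have c: "(b ?x)\<^sup>2 \<noteq> 0" using b(2) by simp
  show ?thesis
    by (rule that[OF X]) (use independent_dual_family[of Basis _ "\<lambda>i. X i p" y, OF finite_Basis c Xy] in auto)
qed

text \<open>Since the coordinate fields already span \<open>DIM('e)\<close> dimensions, the converse inclusion, which
  usually rests on Hadamard's lemma, can be replaced by an a priori bound for the dimension.\<close>

lemma vector_field_through:
  assumes "finite S" "card S \<le> DIM('e)" "tangent_space A p \<subseteq> span S" "v \<in> tangent_space A p"
  obtains X where "X \<in> vector_fields A" "X p = v"
proof -
  obtain X :: "'e \<Rightarrow> 'm vfield" where X: "\<And>i. X i \<in> vector_fields A"
    "inj_on (\<lambda>i. X i p) Basis" "independent ((\<lambda>i. X i p) ` Basis)"
    using coordinate_fields[of p] by blast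
  let ?B = "(\<lambda>i. X i p) ` Basis"
  have "v \<in> span ?B"
  proof (rule ccontr)
    assume v: "v \<notin> span ?B"
    then have "independent (insert v ?B)" using X(3) by (simp add: independent_insert)
    moreover have "insert v ?B \<subseteq> span S"
      using assms(3,4) vector_field_tangent[OF X(1)] by blast
    ultimately have "card (insert v ?B) \<le> card S"
      using real_vector.independent_span_bound[OF assms(1)] by blast
    moreover have "v \<notin> ?B" using v span_base[of v ?B] by metis
    then have "card (insert v ?B) = DIM('e) + 1" by (simp add: card_image[OF X(2)])
    ultimately show False using assms(2) by simp
  qed
  moreover have "span ?B \<subseteq> {X p | X. X \<in> vector_fields A}"
    using X(1) by (intro span_minimal[OF _ subspace_vector_field_values]) blast
  ultimately show ?thesis using that by blast
qed

text \<open>The exchange lemma from both sides: a basis is at most as large as the spanning set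
  \<open>S\<close> and at least as large as the independent family of coordinate vectors.\<close>

lemma card_tangent_basis:
  assumes "finite S" "card S \<le> DIM('e)" "tangent_space A p \<subseteq> span S"
    and "independent B" "span B = tangent_space A p"
  shows "finite B" "card B = DIM('e)"
proof -
  have "B \<subseteq> span S" using assms(3,5) span_superset by blast
  then have B: "finite B" "card B \<le> card S"
    using real_vector.independent_span_bound[OF assms(1,4)] by auto
  then show "finite B" by simp
  obtain X :: "'e \<Rightarrow> 'm vfield" where X: "\<And>i. X i \<in> vector_fields A"
    "inj_on (\<lambda>i. X i p) Basis" "independent ((\<lambda>i. X i p) ` Basis)"
    using coordinate_fields[of p] by blast
  have "(\<lambda>i. X i p) ` Basis \<subseteq> span B" using vector_field_tangent[OF X(1)] assms(5) by blast
  then have "DIM('e) \<le> card B"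
    using real_vector.independent_span_bound[OF B(1) X(3)] by (simp add: card_image[OF X(2)])
  then show "card B = DIM('e)" using B assms(2) by simp
qed

end

section \<open>Linear maps on a subspace and their traces\<close>

lemma linear_on_set_uminus: "linear_on_set T L \<Longrightarrow> x \<in> T \<Longrightarrow> L (- x) = - L x"
  unfolding linear_on_set_def by (metis scaleR_minus1_left)

lemma linear_on_set_diff:
  "linear_on_set T L \<Longrightarrow> subspace T \<Longrightarrow> x \<in> T \<Longrightarrow> y \<in> T \<Longrightarrow> L (x - y) = L x - L y"
  using linear_on_set_uminus[of T L y] subspace_neg[of T y]
  by (simp add: linear_on_set_def flip: add_uminus_conv_diff)

lemma linear_on_set_zero: "linear_on_set T L \<Longrightarrow> subspace T \<Longrightarrow> L 0 = 0"
  using linear_on_set_diff[of T L 0 0] subspace_0[of T] by simp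

lemma linear_on_set_sum:
  assumes "linear_on_set T L" "subspace T" "\<And>i. i \<in> I \<Longrightarrow> x i \<in> T"
  shows "L (\<Sum>i\<in>I. x i) = (\<Sum>i\<in>I. L (x i))"
  using assms(3)
proof (induction I rule: infinite_finite_induct)
  case (insert i I)
  have "(\<Sum>i\<in>I. x i) \<in> T" using insert.prems by (intro subspace_sum assms(2)) auto
  then show ?case using insert assms(1) by (simp add: linear_on_set_def)
qed (simp_all add: linear_on_set_zero[OF assms(1,2)])

lemma representation_real_diff:
  assumes "independent B" "v \<in> span B" "w \<in> span B"
  shows "representation B (v - w) b = representation B v b - representation B w b"
  using real_vector.representation_diff[OF assms(1,3,2)] by simp

text \<open>The diagonal coefficients of the rank-one part add up to \<open>\<omega> z = 1\<close>:
  linearity moves the coordinates of \<open>z\<close> inside \<open>\<omega>\<close>, where they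
  reassemble \<open>z\<close>. The identity contributes \<open>N\<close>. Assumption
  \<open>N\<close> covers all bases because \<open>trace_on\<close> picks an unspecified
  one.\<close>

lemma trace_on_rank_one_minus_identity:
  fixes T :: "'a::real_vector set"
  assumes T: "subspace T" and \<omega>: "linear_on_set T \<omega>" and z: "z \<in> T" "\<omega> z = (1::real)"
    and L: "\<And>v. v \<in> T \<Longrightarrow> L v = \<omega> v *\<^sub>R z - v"
    and N: "\<And>B. independent B \<Longrightarrow> span B = T \<Longrightarrow> finite B \<and> card B = N"
  shows "trace_on T L = 1 - real N"
proof -
  define B where "B = (SOME B. independent B \<and> span B = T)"
  have "\<exists>B. independent B \<and> span B = T"
    using real_vector.maximal_independent_subset[of T] span_minimal[OF _ T] by (metis subset_antisym)
  then have B: "independent B" "span B = T" unfolding B_def by (metis (mono_tags, lifting) someI_ex)+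
  then have fin: "finite B" "card B = N" using N by auto
  have BT: "b \<in> T" if "b \<in> B" for b using B(2) span_base that by blast
  have "representation B (L b) b = representation B z b * \<omega> b - 1" if b: "b \<in> B" for b
    using b z(1) B(2) BT[OF b] T
    by (simp add: L representation_real_diff[OF B(1)] real_vector.representation_scale[OF B(1)]
        real_vector.representation_basis[OF B(1) b] subspace_scale)
  then have "trace_on T L = (\<Sum>b\<in>B. representation B z b * \<omega> b - 1)"
    unfolding trace_on_def B_def[symmetric] Let_def by (rule sum.cong[OF refl])
  also have "\<dots> = (\<Sum>b\<in>B. \<omega> (representation B z b *\<^sub>R b)) - real N"
    using \<omega> BT fin by (simp add: sum_subtractf linear_on_set_def)
  also have "(\<Sum>b\<in>B. \<omega> (representation B z b *\<^sub>R b)) = \<omega> (\<Sum>b\<in>B. representation B z b *\<^sub>R b)"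
    by (rule linear_on_set_sum[OF \<omega> T, symmetric]) (simp add: BT T subspace_scale)
  also have "(\<Sum>b\<in>B. representation B z b *\<^sub>R b) = z"
    using real_vector.sum_representation_eq[OF B(1) _ fin(1) subset_refl] z(1) B(2) by simp
  finally show ?thesis using z(2) by simp
qed

section \<open>Bracket identities for vector fields\<close>

context smooth_manifold
begin

text \<open>Testing on smooth functions suffices because tangent vectors are extended by zero to all
  others.\<close>

lemma vector_field_eqI:
  assumes X: "X \<in> vector_fields A" and Y: "Y \<in> vector_fields A"
    and eq: "\<And>f. f \<in> smooth_functions A \<Longrightarrow> lie_derivative_fun X f = lie_derivative_fun Y f"
  shows "X = Y"
proof (intro ext)
  fix p f
  have "lie_derivative_fun X f = lie_derivative_fun Y f"
    using eq vector_field_nonsmooth[OF X] vector_field_nonsmooth[OF Y] by metis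
  then show "X p f = Y p f" by (simp add: lie_derivative_fun_def fun_eq_iff)
qed

lemma lie_bracket_anticomm: "lie_bracket X Y = - lie_bracket Y X"
  by (simp add: lie_bracket_def fun_eq_iff)

lemma lie_bracket_zero_left: "Y \<in> vector_fields A \<Longrightarrow> lie_bracket 0 Y = 0"
  using tangent_zero[OF vector_field_tangent]
  by (simp add: lie_bracket_def fun_eq_iff lie_derivative_fun_def zero_fun_def)

text \<open>The Jacobi identity written as a Leibniz rule for \<open>lie_bracket Z\<close>, the form
  in which the Lie derivative along \<open>\<zeta>\<close> passes through
  \<open>d\<eta>\<close>.\<close>

lemma lie_bracket_jacobi:
  assumes "X \<in> vector_fields A" "Y \<in> vector_fields A" "Z \<in> vector_fields A"
  shows "lie_bracket Z (lie_bracket X Y) =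
    lie_bracket (lie_bracket Z X) Y + lie_bracket X (lie_bracket Z Y)"
proof (rule vector_field_eqI)
  fix f assume "f \<in> smooth_functions A"
  moreover have "lie_derivative_fun (V + W) f = lie_derivative_fun V f + lie_derivative_fun W f"
    for V W and f :: "'m \<Rightarrow> real"
    by (simp add: lie_derivative_fun_def fun_eq_iff)
  ultimately show "lie_derivative_fun (lie_bracket Z (lie_bracket X Y)) f =
      lie_derivative_fun (lie_bracket (lie_bracket Z X) Y + lie_bracket X (lie_bracket Z Y)) f"
    using assms by (simp add: lie_derivative_bracket lie_derivative_diff vector_field_smooth)
qed (simp_all add: assms vector_fields_bracket vector_fields_add)

end

section \<open>The structure vector field of a para-Sasakian manifold\<close>

locale para_sasakian =
  fixes A :: "('m::{t2_space, second_countable_topology}, 'e::euclidean_space) atlas"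
    and n :: nat
    and \<phi> :: "'m endo_field" and \<zeta> :: "'m vfield" and \<eta> :: "'m one_form"
    and g :: "'m bilinear_field"
  assumes n: "n \<ge> 1" and para_sasakian: "para_sasakian_manifold A n \<phi> \<zeta> \<eta> g"
begin

abbreviation "\<X> \<equiv> vector_fields A"
abbreviation "Lie \<equiv> lie_derivative_fun"
abbreviation "Br \<equiv> lie_bracket"
abbreviation "\<Phi> \<equiv> apply_endo \<phi>"
abbreviation "E \<equiv> apply_form \<eta>"
abbreviation "G \<equiv> apply_bilinear g"

lemma almost_paracontact: "almost_paracontact_metric_manifold A n \<phi> \<zeta> \<eta> g"
  using para_sasakian by (simp add: para_sasakian_manifold_def paracontact_metric_manifold_def)

sublocale smooth_manifold A
  using almost_paracontact by unfold_locales (simp add: almost_paracontact_metric_manifold_def)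

lemma dim_model: "DIM('e) = 2 * n + 1"
  and zeta_field: "\<zeta> \<in> \<X>"
  and phi_phi: "v \<in> tangent_space A p \<Longrightarrow> \<phi> p (\<phi> p v) = v - \<eta> p v *\<^sub>R \<zeta> p"
  and eta_zeta: "\<eta> p (\<zeta> p) = 1"
  and g_phi_phi: "v \<in> tangent_space A p \<Longrightarrow> w \<in> tangent_space A p \<Longrightarrow>
        g p (\<phi> p v) (\<phi> p w) = - g p v w + \<eta> p v * \<eta> p w"
  and dim_eigenspaces: "dim {v \<in> tangent_space A p. \<eta> p v = 0 \<and> \<phi> p v = v} = n"
    "dim {v \<in> tangent_space A p. \<eta> p v = 0 \<and> \<phi> p v = - v} = n"
  using almost_paracontact by (simp_all add: almost_paracontact_metric_manifold_def)

lemma phi_linear: "linear_on_set (tangent_space A p) (\<phi> p)"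
  and phi_tangent: "v \<in> tangent_space A p \<Longrightarrow> \<phi> p v \<in> tangent_space A p"
  and Phi_field: "X \<in> \<X> \<Longrightarrow> \<Phi> X \<in> \<X>"
  and eta_linear: "linear_on_set (tangent_space A p) (\<eta> p)"
  and E_smooth: "X \<in> \<X> \<Longrightarrow> E X \<in> smooth_functions A"
  and g_linear_right: "v \<in> tangent_space A p \<Longrightarrow> linear_on_set (tangent_space A p) (g p v)"
  and g_linear_left: "v \<in> tangent_space A p \<Longrightarrow> linear_on_set (tangent_space A p) (\<lambda>u. g p u v)"
  and G_smooth: "X \<in> \<X> \<Longrightarrow> Y \<in> \<X> \<Longrightarrow> G X Y \<in> smooth_functions A"
  and g_sym: "v \<in> tangent_space A p \<Longrightarrow> w \<in> tangent_space A p \<Longrightarrow> g p v w = g p w v"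
  and g_nondegenerate:
    "v \<in> tangent_space A p \<Longrightarrow> (\<And>w. w \<in> tangent_space A p \<Longrightarrow> g p v w = 0) \<Longrightarrow> v = 0"
  using almost_paracontact
  by (auto simp: almost_paracontact_metric_manifold_def smooth_endo_field_def smooth_one_form_def
      semi_riemannian_metric_def smooth_bilinear_field_def)

section \<open>Pointwise algebra of the structure tensors\<close>

lemma zeta_tangent: "\<zeta> p \<in> tangent_space A p"
  using zeta_field by (rule vector_field_tangent)

lemma zeta_nonzero: "\<zeta> p \<noteq> 0"
  using eta_zeta[of p] linear_on_set_zero[OF eta_linear[of p] subspace_tangent_space] by auto

text \<open>The square of \<open>\<phi>\<close> kills \<open>\<zeta>\<close>. Applied to
  \<open>\<phi> \<zeta>\<close>, the formula for that square gives
  \<open>\<phi> \<zeta> = c \<zeta>\<close>; one more \<open>\<phi>\<close> gives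
  \<open>c \<phi> \<zeta> = 0\<close>, and either vanishing factor yields the claim.\<close>

lemma phi_zeta: "\<phi> p (\<zeta> p) = 0"
proof -
  let ?c = "\<eta> p (\<phi> p (\<zeta> p))"
  have phi0: "\<phi> p 0 = 0" by (rule linear_on_set_zero[OF phi_linear subspace_tangent_space])
  have 0: "\<phi> p (\<phi> p (\<zeta> p)) = 0" using phi_phi[OF zeta_tangent[of p]] by (simp add: eta_zeta)
  then have "\<phi> p (\<phi> p (\<phi> p (\<zeta> p))) = 0" using phi0 by simp
  then have 1: "\<phi> p (\<zeta> p) = ?c *\<^sub>R \<zeta> p"
    using phi_phi[OF phi_tangent[OF zeta_tangent[of p]]] by simp
  then have "\<phi> p (\<phi> p (\<zeta> p)) = ?c *\<^sub>R \<phi> p (\<zeta> p)"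
    using phi_linear[of p] zeta_tangent[of p] unfolding linear_on_set_def by metis
  with 0 1 show ?thesis by auto
qed

text \<open>Computing the third power of \<open>\<phi>\<close> on \<open>v\<close> in two ways
  leaves a multiple of the nonzero vector \<open>\<zeta>\<close> that must vanish.\<close>

lemma eta_phi:
  assumes v: "v \<in> tangent_space A p"
  shows "\<eta> p (\<phi> p v) = 0"
proof -
  have "\<phi> p (\<phi> p (\<phi> p v)) = \<phi> p v - \<phi> p (\<eta> p v *\<^sub>R \<zeta> p)"
    using phi_phi[OF v] v zeta_tangent[of p]
    by (simp add: linear_on_set_diff[OF phi_linear subspace_tangent_space] subspace_tangent_space subspace_scale)
  also have "\<phi> p (\<eta> p v *\<^sub>R \<zeta> p) = 0"
    using phi_linear[of p] zeta_tangent[of p] by (simp add: linear_on_set_def phi_zeta)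
  finally have "\<phi> p v - \<eta> p (\<phi> p v) *\<^sub>R \<zeta> p = \<phi> p v"
    using phi_phi[OF phi_tangent[OF v]] by (metis diff_zero)
  moreover have "\<eta> p (\<phi> p v) *\<^sub>R \<zeta> p
      = \<phi> p v - (\<phi> p v - \<eta> p (\<phi> p v) *\<^sub>R \<zeta> p)"
    by (simp only: diff_diff_eq2 add_diff_cancel_left')
  ultimately have "\<eta> p (\<phi> p v) *\<^sub>R \<zeta> p = 0" by (simp only: diff_self)
  then show ?thesis using zeta_nonzero[of p] by simp
qed

lemma g_zeta: "v \<in> tangent_space A p \<Longrightarrow> g p v (\<zeta> p) = \<eta> p v"
  using g_phi_phi[OF _ zeta_tangent, of v p] linear_on_set_zero[OF g_linear_right subspace_tangent_space]
  by (simp add: phi_zeta eta_zeta phi_tangent)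

text \<open>This is \<open>g_phi_phi\<close> with \<open>\<phi> p v\<close> in place of
  \<open>v\<close>; the correction terms vanish because \<open>\<eta>\<close> kills the image of
  \<open>\<phi>\<close>.\<close>

lemma g_phi_skew:
  assumes v: "v \<in> tangent_space A p" and w: "w \<in> tangent_space A p"
  shows "g p (\<phi> p v) w = - g p v (\<phi> p w)"
proof -
  have "g p v (\<phi> p w) - g p (\<eta> p v *\<^sub>R \<zeta> p) (\<phi> p w) = g p (\<phi> p (\<phi> p v)) (\<phi> p w)"
    using v w zeta_tangent
    by (simp add: phi_phi linear_on_set_diff[OF g_linear_left subspace_tangent_space]
        phi_tangent subspace_scale subspace_tangent_space)
  also have "\<dots> = - g p (\<phi> p v) w"
    using g_phi_phi[OF phi_tangent[OF v] w] by (simp add: eta_phi[OF v])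
  also have "g p (\<eta> p v *\<^sub>R \<zeta> p) (\<phi> p w) = 0"
    using g_linear_left[OF phi_tangent[OF w]] zeta_tangent[of p] g_sym[OF zeta_tangent phi_tangent[OF w]]
    by (simp add: linear_on_set_def g_zeta phi_tangent w eta_phi)
  finally show ?thesis by simp
qed

text \<open>Modulo \<open>\<zeta>\<close> a vector \<open>v\<close> equals
  \<open>w = \<phi> (\<phi> v)\<close>, and \<open>w\<close> is half the sum of
  \<open>w + \<phi> v\<close> and \<open>w - \<phi> v\<close>, which are eigenvectors for 1 and -1.
  Thus \<open>\<zeta>\<close> and bases of the two eigenspaces span, at most
  \<open>1 + n + n\<close> vectors.\<close>

lemma tangent_space_spanned:
  obtains S where "finite S" "card S \<le> DIM('e)" "tangent_space A p \<subseteq> span S"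
proof -
  let ?T = "tangent_space A p"
  let ?P = "{v \<in> ?T. \<eta> p v = 0 \<and> \<phi> p v = v}" and ?M = "{v \<in> ?T. \<eta> p v = 0 \<and> \<phi> p v = - v}"
  note T = subspace_tangent_space[of p]
  obtain B where B: "?P \<subseteq> span B" "card B = n"
    using real_vector.basis_exists[of ?P, unfolded dim_eigenspaces] by blast
  obtain C where C: "?M \<subseteq> span C" "card C = n"
    using real_vector.basis_exists[of ?M, unfolded dim_eigenspaces] by blast
  let ?S = "insert (\<zeta> p) (B \<union> C)"
  \<comment> \<open>An infinite set has cardinality 0, so \<open>dim\<close> would also be 0 on an
    infinite-dimensional eigenspace; \<open>n \<ge> 1\<close> excludes this.\<close>
  have fin: "finite B" "finite C" using B(2) C(2) n card.infinite[of B] card.infinite[of C] by auto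
  have "card ?S \<le> DIM('e)"
    using card_insert_le_m1[of "2 * n + 1" "B \<union> C" "\<zeta> p"] card_Un_le[of B C] B(2) C(2)
    unfolding dim_model by linarith
  moreover have "v \<in> span ?S" if v: "v \<in> ?T" for v
  proof -
    let ?w = "\<phi> p (\<phi> p v)"
    have w: "?w \<in> ?T" "\<phi> p v \<in> ?T" using v phi_tangent by blast+
    have www: "\<phi> p ?w = \<phi> p v"
      using phi_phi[OF w(2)] by (simp add: eta_phi[OF v])
    have P: "?w + \<phi> p v \<in> ?P"
      using phi_linear[of p] eta_linear[of p] w www
      by (auto simp: linear_on_set_def eta_phi v add.commute intro: subspace_add[OF T])
    have M: "?w - \<phi> p v \<in> ?M"
      using w www
      by (auto simp: linear_on_set_diff[OF phi_linear T] linear_on_set_diff[OF eta_linear T]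
          eta_phi v intro: subspace_diff[OF T])
    have PM: "?w + \<phi> p v \<in> span ?S" "?w - \<phi> p v \<in> span ?S"
      using P M B(1) C(1) span_mono[of B ?S] span_mono[of C ?S] by blast+
    have "?w = (1/2) *\<^sub>R ((?w + \<phi> p v) + (?w - \<phi> p v))"
      by (simp add: fun_eq_iff scaleR_fun_def)
    then have "?w \<in> span ?S" using span_scale[OF span_add[OF PM], of "1/2"] by simp
    moreover have "\<eta> p v *\<^sub>R \<zeta> p \<in> span ?S" by (intro span_scale span_base) simp
    ultimately have "?w + \<eta> p v *\<^sub>R \<zeta> p \<in> span ?S" by (rule span_add)
    then show ?thesis using phi_phi[OF v] by simp
  qed
  ultimately show ?thesis using that[of ?S] fin by blast
qed

lemma field_through:
  assumes "v \<in> tangent_space A p"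
  shows "field_through A p v \<in> \<X>" "field_through A p v p = v"
proof -
  obtain S where "finite S" "card S \<le> DIM('e)" "tangent_space A p \<subseteq> span S"
    using tangent_space_spanned by blast
  then have "\<exists>X. X \<in> \<X> \<and> X p = v" using vector_field_through assms by metis
  then have "field_through A p v \<in> \<X> \<and> field_through A p v p = v"
    unfolding field_through_def by (rule someI_ex)
  then show "field_through A p v \<in> \<X>" "field_through A p v p = v" by auto
qed

lemma tangent_basis:
  assumes "independent B" "span B = tangent_space A p"
  shows "finite B \<and> card B = 2 * n + 1"
  using tangent_space_spanned[of p] card_tangent_basis[OF _ _ _ assms] dim_model by metis

section \<open>The structure tensors acting on vector fields\<close>

lemma Phi_diff: "X \<in> \<X> \<Longrightarrow> Y \<in> \<X> \<Longrightarrow> \<Phi> (X - Y) = \<Phi> X - \<Phi> Y"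
  by (rule ext)
     (simp add: apply_endo_def linear_on_set_diff[OF phi_linear subspace_tangent_space]
       vector_field_tangent fun_eq_iff)

lemma Phi_uminus: "X \<in> \<X> \<Longrightarrow> \<Phi> (- X) = - \<Phi> X"
  by (rule ext)
     (simp add: apply_endo_def linear_on_set_uminus[OF phi_linear] vector_field_tangent fun_eq_iff)

lemma Phi_Phi: "X \<in> \<X> \<Longrightarrow> \<Phi> (\<Phi> X) = X - scale_field (E X) \<zeta>"
  by (rule ext)
     (simp add: apply_endo_def apply_form_def scale_field_def phi_phi vector_field_tangent fun_eq_iff)

lemma Phi_zeta: "\<Phi> \<zeta> = 0"
  by (simp add: apply_endo_def phi_zeta fun_eq_iff)

lemma E_zeta: "E \<zeta> = (\<lambda>_. 1)"
  by (simp add: apply_form_def eta_zeta)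

lemma E_Phi: "X \<in> \<X> \<Longrightarrow> E (\<Phi> X) = 0"
  by (rule ext) (simp add: apply_form_def apply_endo_def eta_phi vector_field_tangent)

lemma E_diff: "X \<in> \<X> \<Longrightarrow> Y \<in> \<X> \<Longrightarrow> E (X - Y) = E X - E Y"
  by (rule ext)
     (simp add: apply_form_def linear_on_set_diff[OF eta_linear subspace_tangent_space]
       vector_field_tangent)

lemma G_sym: "X \<in> \<X> \<Longrightarrow> Y \<in> \<X> \<Longrightarrow> G X Y = G Y X"
  by (rule ext) (simp add: apply_bilinear_def g_sym vector_field_tangent)

lemma G_diff_left: "X \<in> \<X> \<Longrightarrow> Y \<in> \<X> \<Longrightarrow> Z \<in> \<X> \<Longrightarrow> G (X - Y) Z = G X Z - G Y Z"
  by (rule ext)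
     (simp add: apply_bilinear_def linear_on_set_diff[OF g_linear_left subspace_tangent_space]
       vector_field_tangent)

lemma G_diff_right: "X \<in> \<X> \<Longrightarrow> Y \<in> \<X> \<Longrightarrow> Z \<in> \<X> \<Longrightarrow> G Z (X - Y) = G Z X - G Z Y"
  by (simp add: G_sym[of Z] vector_fields_diff G_diff_left)

lemma E_add: "X \<in> \<X> \<Longrightarrow> Y \<in> \<X> \<Longrightarrow> E (X + Y) = E X + E Y"
  using E_diff[OF vector_fields_add, of X Y Y] by (simp add: algebra_simps)

lemma G_zeta: "X \<in> \<X> \<Longrightarrow> G X \<zeta> = E X"
  by (rule ext) (simp add: apply_bilinear_def apply_form_def g_zeta vector_field_tangent)

lemma G_Phi: "X \<in> \<X> \<Longrightarrow> Y \<in> \<X> \<Longrightarrow> G (\<Phi> X) Y = - G X (\<Phi> Y)"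
  by (rule ext) (simp add: apply_bilinear_def apply_endo_def g_phi_skew vector_field_tangent)

lemma G_scale_zeta:
  assumes "X \<in> \<X>" "f \<in> smooth_functions A"
  shows "G X (scale_field f \<zeta>) = f * E X"
proof (rule ext)
  fix p
  have "g p (X p) (f p *\<^sub>R \<zeta> p) = f p * g p (X p) (\<zeta> p)"
    using g_linear_right[OF vector_field_tangent[OF assms(1)]] zeta_tangent
    by (simp add: linear_on_set_def)
  then show "G X (scale_field f \<zeta>) p = (f * E X) p"
    by (simp add: apply_bilinear_def scale_field_def apply_form_def g_zeta
        vector_field_tangent[OF assms(1)])
qed

section \<open>Invariance of the structure along \<zeta>\<close>

lemma deta:
  assumes "X \<in> \<X>" "Y \<in> \<X>"
  shows "Lie X (E Y) - Lie Y (E X) - E (Br X Y) = 2 *\<^sub>R G X (\<Phi> Y)"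
proof -
  have "exterior_derivative \<eta> X Y = G X (\<Phi> Y)"
    using para_sasakian assms
    by (simp add: para_sasakian_manifold_def paracontact_metric_manifold_def)
  then show ?thesis
    by (auto simp: exterior_derivative_def fun_eq_iff scaleR_fun_def field_simps)
qed

text \<open>In \<open>deta\<close> at \<open>\<zeta>\<close> the derivative of the constant
  \<open>E \<zeta>\<close> drops out, and the right side is \<open>\<eta> (\<phi> X) = 0\<close>
  because \<open>g\<close> lowers \<open>\<zeta>\<close> to \<open>\<eta>\<close>.\<close>

lemma eta_invariant:
  assumes X: "X \<in> \<X>"
  shows "E (Br \<zeta> X) = Lie \<zeta> (E X)"
proof -
  have "G \<zeta> (\<Phi> X) = 0"
    using G_sym[OF zeta_field Phi_field[OF X]] G_zeta[OF Phi_field[OF X]] E_Phi[OF X] by simp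
  then show ?thesis
    using deta[OF zeta_field X] by (simp add: E_zeta lie_derivative_const[OF X])
qed

text \<open>The case \<open>X = \<zeta>\<close> of normality: it gives \<open>\<phi>(\<pounds>\<^sub>\<zeta> \<phi>) = 0\<close>, and \<open>\<eta>(\<pounds>\<^sub>\<zeta> \<phi>) = 0\<close> by the
  invariance of \<open>\<eta>\<close>.\<close>

lemma phi_invariant:
  assumes X: "X \<in> \<X>"
  shows "Br \<zeta> (\<Phi> X) = \<Phi> (Br \<zeta> X)"
proof -
  let ?W = "\<Phi> (Br \<zeta> X) - Br \<zeta> (\<Phi> X)"
  note fields = zeta_field X vector_fields_bracket Phi_field vector_fields_diff
  have "exterior_derivative \<eta> \<zeta> X = G \<zeta> (\<Phi> X)"
    using para_sasakian fields
    by (simp add: para_sasakian_manifold_def paracontact_metric_manifold_def)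
  also have "\<dots> = 0"
    using G_sym[OF zeta_field Phi_field[OF X]] G_zeta[OF Phi_field[OF X]] E_Phi[OF X] by simp
  finally have "scale_field (2 *\<^sub>R exterior_derivative \<eta> \<zeta> X) \<zeta> = 0"
    by (simp add: scale_field_def scaleR_fun_def fun_eq_iff)
  moreover have "nijenhuis_torsion \<phi> \<zeta> X - scale_field (2 *\<^sub>R exterior_derivative \<eta> \<zeta> X) \<zeta> = 0"
    using para_sasakian fields by (simp add: para_sasakian_manifold_def normal_structure_def)
  ultimately have "nijenhuis_torsion \<phi> \<zeta> X = 0" by simp
  moreover have "\<Phi> 0 = 0"
    using Phi_diff[OF zeta_field zeta_field] by simp
  ultimately have "\<Phi> (\<Phi> (Br \<zeta> X)) - \<Phi> (Br \<zeta> (\<Phi> X)) = 0"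
    by (simp add: nijenhuis_torsion_def Phi_zeta lie_bracket_zero_left fields)
  then have "\<Phi> ?W = 0" by (simp add: Phi_diff fields)
  then have "\<Phi> (\<Phi> ?W) = 0" using \<open>\<Phi> 0 = 0\<close> by simp
  moreover have "E ?W = 0"
    using lie_derivative_const[OF zeta_field, of 0]
    by (simp add: E_diff E_Phi eta_invariant fields zero_fun_def)
  then have "scale_field (E ?W) \<zeta> = 0" by (simp add: scale_field_def fun_eq_iff)
  \<comment> \<open>On the kernel of \<open>\<eta>\<close> the square of \<open>\<phi>\<close> is
    the identity, so \<open>\<phi>\<close> is injective there.\<close>
  ultimately have "?W = 0" using Phi_Phi[of ?W] fields by simp
  then show ?thesis by simp
qed

text \<open>The Lie derivative along \<open>\<zeta>\<close> commutes with \<open>d\<close>, here by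
  hand: each term of \<open>deta\<close> is differentiated, and the Jacobi identity with the
  invariance of \<open>\<eta>\<close> reassembles the results. By \<open>phi_invariant\<close> the
  outcome is the Killing equation for pairs whose second member lies in the image of
  \<open>\<phi>\<close>.\<close>

lemma g_phi_invariant:
  assumes X: "X \<in> \<X>" and Y: "Y \<in> \<X>"
  shows "Lie \<zeta> (G X (\<Phi> Y)) = G (Br \<zeta> X) (\<Phi> Y) + G X (Br \<zeta> (\<Phi> Y))"
proof -
  note fields = zeta_field X Y vector_fields_bracket
  note smooth = vector_field_smooth E_smooth smooth_functions_diff
  let ?R = "Lie \<zeta> (Lie X (E Y)) - Lie \<zeta> (Lie Y (E X)) - Lie \<zeta> (E (Br X Y))"
  have "2 *\<^sub>R Lie \<zeta> (G X (\<Phi> Y)) = ?R"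
    using fields smooth
    by (simp add: lie_derivative_diff[symmetric] deta lie_derivative_scaleR G_smooth Phi_field)
  also have "\<dots> = 2 *\<^sub>R G (Br \<zeta> X) (\<Phi> Y) + 2 *\<^sub>R G X (\<Phi> (Br \<zeta> Y))"
    using fields
    by (simp add: deta[symmetric] lie_derivative_bracket eta_invariant lie_bracket_jacobi[of X Y \<zeta>]
        E_add flip: eta_invariant[of "Br X Y"])
  finally have "2 *\<^sub>R Lie \<zeta> (G X (\<Phi> Y)) = 2 *\<^sub>R (G (Br \<zeta> X) (\<Phi> Y) + G X (Br \<zeta> (\<Phi> Y)))"
    by (simp only: scaleR_add_right phi_invariant[OF Y])
  then show ?thesis by (simp only: scaleR_cancel_left) simp
qed

text \<open>The second argument is split into its part in the image of \<open>\<phi>\<close>, where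
  \<open>g_phi_invariant\<close> applies, and its part along \<open>\<zeta>\<close>, which
  contributes a product of two invariant functions of the fields, handled by the Leibniz
  rule.\<close>

lemma zeta_killing:
  assumes X: "X \<in> \<X>" and Y: "Y \<in> \<X>"
  shows "Lie \<zeta> (G X Y) = G (Br \<zeta> X) Y + G X (Br \<zeta> Y)"
proof -
  note fields = zeta_field X Y vector_fields_bracket Phi_field vector_fields_scale E_smooth
  have split: "G V W = G V (\<Phi> (\<Phi> W)) + E W * E V" if "V \<in> \<X>" "W \<in> \<X>" for V W
    using that by (simp add: Phi_Phi G_diff_right G_scale_zeta fields)
  have "Lie \<zeta> (G X Y) = Lie \<zeta> (G X (\<Phi> (\<Phi> Y))) + Lie \<zeta> (E Y * E X)"
    by (subst split[OF X Y])
       (simp add: lie_derivative_add G_smooth smooth_functions_mult fields)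
  also have "Lie \<zeta> (G X (\<Phi> (\<Phi> Y))) = G (Br \<zeta> X) (\<Phi> (\<Phi> Y)) + G X (\<Phi> (\<Phi> (Br \<zeta> Y)))"
    by (simp add: g_phi_invariant phi_invariant fields)
  also have "Lie \<zeta> (E Y * E X) = E Y * E (Br \<zeta> X) + E X * E (Br \<zeta> Y)"
    by (simp add: lie_derivative_mult eta_invariant fields)
  finally show ?thesis
    using split[of "Br \<zeta> X" Y] split[of X "Br \<zeta> Y"] fields by (simp add: algebra_simps fun_eq_iff)
qed

end

section \<open>The Levi-Civita connection and the curvature along \<zeta>\<close>

locale para_sasakian_levi_civita = para_sasakian A n \<phi> \<zeta> \<eta> g
  for A :: "('m::{t2_space, second_countable_topology}, 'e::euclidean_space) atlas"
    and n \<phi> \<zeta> \<eta> g +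
  fixes D :: "'m connection"
  assumes levi_civita: "levi_civita_connection A g D"
begin

lemma D_field: "X \<in> \<X> \<Longrightarrow> Y \<in> \<X> \<Longrightarrow> D X Y \<in> \<X>"
  and D_add: "X \<in> \<X> \<Longrightarrow> Y \<in> \<X> \<Longrightarrow> Z \<in> \<X> \<Longrightarrow> D X (Y + Z) = D X Y + D X Z"
  and torsion_free: "X \<in> \<X> \<Longrightarrow> Y \<in> \<X> \<Longrightarrow> D X Y - D Y X = Br X Y"
  and metric: "X \<in> \<X> \<Longrightarrow> Y \<in> \<X> \<Longrightarrow> Z \<in> \<X> \<Longrightarrow> Lie X (G Y Z) = G (D X Y) Z + G Y (D X Z)"
  using levi_civita by (simp_all add: levi_civita_connection_def affine_connection_def)

lemma D_zero: "X \<in> \<X> \<Longrightarrow> D X 0 = 0"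
  using D_add[OF _ vector_fields_zero vector_fields_zero] by simp

lemma D_uminus: "X \<in> \<X> \<Longrightarrow> Y \<in> \<X> \<Longrightarrow> D X (- Y) = - D X Y"
  using D_add[OF _ _ vector_fields_uminus, of X Y Y]
  by (simp add: D_zero eq_neg_iff_add_eq_0 add.commute)

text \<open>Nondegeneracy concerns single tangent vectors, so each test vector \<open>w\<close> has
  to be extended to a field.\<close>

lemma field_eqI:
  assumes X: "X \<in> \<X>" and Y: "Y \<in> \<X>" and eq: "\<And>Z. Z \<in> \<X> \<Longrightarrow> G X Z = G Y Z"
  shows "X = Y"
proof
  fix p
  note fields = vector_field_tangent[OF X] vector_field_tangent[OF Y]
  have "X p - Y p = 0"
  proof (rule g_nondegenerate)
    show "X p - Y p \<in> tangent_space A p" using fields subspace_diff subspace_tangent_space by blast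
    fix w assume w: "w \<in> tangent_space A p"
    have "g p (X p) w = g p (Y p) w"
      using eq[OF field_through(1)[OF w]] field_through(2)[OF w]
      by (metis apply_bilinear_def)
    then show "g p (X p - Y p) w = 0"
      using linear_on_set_diff[OF g_linear_left[OF w] subspace_tangent_space fields] by simp
  qed
  then show "X p = Y p" by simp
qed

text \<open>The Killing equation kills the symmetric part of
  \<open>g(\<nabla>_X \<zeta>, Y)\<close>, and \<open>deta\<close> gives its skew part, since metric
  compatibility with \<open>\<eta> = g(_, \<zeta>)\<close> rewrites \<open>d\<eta>\<close> in terms
  of \<open>\<nabla>\<zeta>\<close>. Adding both equations determines
  \<open>\<nabla>\<zeta>\<close>.\<close>

lemma D_zeta:
  assumes X: "X \<in> \<X>"
  shows "D X \<zeta> = - \<Phi> X"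
proof (rule field_eqI)
  fix Y assume Y: "Y \<in> \<X>"
  note fields = zeta_field X Y Phi_field D_field
  have "G (Br \<zeta> X) Y = G (D \<zeta> X) Y - G (D X \<zeta>) Y"
    "G X (Br \<zeta> Y) = G X (D \<zeta> Y) - G X (D Y \<zeta>)"
    by (simp_all add: G_diff_left G_diff_right fields flip: torsion_free)
  then have 1: "G (D X \<zeta>) Y + G X (D Y \<zeta>) = 0"
    using zeta_killing[OF X Y] metric[OF zeta_field X Y]
    by (simp add: fun_eq_iff) (metis add.left_inverse)
  have E: "Lie V (E W) = E (D V W) + G W (D V \<zeta>)" if "V \<in> \<X>" "W \<in> \<X>" for V W
    using metric[OF that zeta_field] that by (simp add: G_zeta fields)
  have 2: "G Y (D X \<zeta>) - G X (D Y \<zeta>) = 2 *\<^sub>R G X (\<Phi> Y)"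
    using deta[OF X Y]
    by (simp add: E fields E_diff flip: torsion_free[OF X Y])
  have "2 *\<^sub>R G (D X \<zeta>) Y = 2 *\<^sub>R (- G (\<Phi> X) Y)"
    using 1 2 by (simp add: G_sym[of Y "D X \<zeta>"] fields G_Phi scaleR_2 eq_neg_iff_add_eq_0 algebra_simps)
  then have "G (D X \<zeta>) Y = - G (\<Phi> X) Y" by (simp only: scaleR_cancel_left) simp
  also have "\<dots> = G (- \<Phi> X) Y"
    using G_diff_left[OF vector_fields_zero Phi_field[OF X] Y] G_diff_left[OF X X Y] by simp
  finally show "G (D X \<zeta>) Y = G (- \<Phi> X) Y" .
qed (simp_all add: X zeta_field D_field Phi_field vector_fields_uminus)

text \<open>The first term dies since
  \<open>\<nabla>_\<zeta> \<zeta> = - \<phi> \<zeta> = 0\<close>. Torsion-freeness and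
  \<open>phi_invariant\<close> evaluate the derivative of \<open>\<Phi> X\<close> along
  \<open>\<zeta>\<close>; its bracket term cancels against the one from
  \<open>D (Br X \<zeta>) \<zeta>\<close>, and only \<open>- \<Phi> (\<Phi> X)\<close>
  survives.\<close>

lemma curvature_zeta:
  assumes X: "X \<in> \<X>"
  shows "curvature D X \<zeta> \<zeta> = scale_field (E X) \<zeta> - X"
proof -
  note fields = X zeta_field Phi_field vector_fields_bracket
  have "D \<zeta> (\<Phi> X) = Br \<zeta> (\<Phi> X) + D (\<Phi> X) \<zeta>"
    using torsion_free[of \<zeta> "\<Phi> X"] fields by (simp add: algebra_simps)
  also have "\<dots> = \<Phi> (Br \<zeta> X) - \<Phi> (\<Phi> X)"
    using fields by (simp add: phi_invariant D_zeta)
  finally have 1: "D \<zeta> (D X \<zeta>) = \<Phi> (\<Phi> X) - \<Phi> (Br \<zeta> X)"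
    using fields by (simp add: D_zeta D_uminus)
  have 2: "D (Br X \<zeta>) \<zeta> = \<Phi> (Br \<zeta> X)"
    using fields by (simp add: D_zeta lie_bracket_anticomm[of X \<zeta>] Phi_uminus vector_fields_uminus)
  have "D X (D \<zeta> \<zeta>) = 0"
    using fields by (simp add: D_zeta Phi_zeta D_zero)
  then show ?thesis
    unfolding curvature_def 1 2 using fields by (simp add: Phi_Phi)
qed

text \<open>The operator to be traced is a rank-one map of trace \<open>\<eta> (\<zeta>) = 1\<close>
  minus the identity in dimension \<open>2 * n + 1\<close>.\<close>

lemma ricci_zeta: "ricci_tensor A D \<zeta> \<zeta> p = - (2 * real n)"
proof -
  have "curvature D (field_through A p v) \<zeta> \<zeta> p = \<eta> p v *\<^sub>R \<zeta> p - v"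
    if "v \<in> tangent_space A p" for v
    using field_through[OF that]
    by (simp add: curvature_zeta scale_field_def apply_form_def)
  then have "ricci_tensor A D \<zeta> \<zeta> p = 1 - real (2 * n + 1)"
    unfolding ricci_tensor_def field_trace_def
    using tangent_basis
    by (rule trace_on_rank_one_minus_identity[of _ "\<eta> p" "\<zeta> p",
          OF subspace_tangent_space eta_linear zeta_tangent eta_zeta])
  then show ?thesis by simp
qed

end

section \<open>Ricci-Yamabe solitons along a Killing field\<close>

theorem theorem5p1:
  fixes A :: "('m::{t2_space, second_countable_topology}, 'e::euclidean_space) atlas"
    and n :: nat
    and \<phi> :: "'m endo_field" and \<zeta> :: "'m vfield" and \<eta> :: "'m one_form"
    and g :: "'m bilinear_field" and D :: "'m connection"
    and h l :: "'m \<Rightarrow> real" and \<alpha> \<beta> :: real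
  assumes "n \<ge> 1"
    and "para_sasakian_manifold A n \<phi> \<zeta> \<eta> g"
    and "levi_civita_connection A g D"
    and "proper_h_almost_ricci_yamabe_soliton A g D \<zeta> h l \<alpha> \<beta>"
  shows "einstein_manifold A g D"
proof -
  interpret para_sasakian_levi_civita A n \<phi> \<zeta> \<eta> g D
    by unfold_locales (fact assms)+
  \<comment> \<open>The full coefficient of the metric is treated as one unknown function; the
    scalar curvature is never evaluated.\<close>
  define s where "s p = l p - \<beta> / 2 * scalar_curvature A g D p" for p
  have soliton: "\<alpha> * ricci_tensor A D X Y p + s p * G X Y p = 0"
    if "X \<in> \<X>" "Y \<in> \<X>" for X Y p
  proof -
    have "lie_derivative_metric \<zeta> g X Y p = 0"
      using zeta_killing[OF that] by (simp add: lie_derivative_metric_def)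
    moreover have "h p / 2 * lie_derivative_metric \<zeta> g X Y p + \<alpha> * ricci_tensor A D X Y p
        + s p * G X Y p = 0"
      using assms(4) that
      by (simp add: proper_h_almost_ricci_yamabe_soliton_def h_almost_ricci_yamabe_soliton_def s_def)
    ultimately show ?thesis by simp
  qed
  have \<alpha>: "\<alpha> \<noteq> 0" using assms(4) by (simp add: proper_h_almost_ricci_yamabe_soliton_def)
  \<comment> \<open>At \<open>X = Y = \<zeta>\<close> one has \<open>S = -2n\<close> and
    \<open>g = \<eta> (\<zeta>) = 1\<close>, which makes \<open>s\<close> constant without separate
    knowledge of \<open>l\<close> or the scalar curvature.\<close>
  have "s p = 2 * \<alpha> * real n" for p
    using soliton[OF zeta_field zeta_field, of p] G_zeta[OF zeta_field]
    by (simp add: ricci_zeta E_zeta)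
  then have "\<alpha> * ricci_tensor A D X Y p = \<alpha> * (- (2 * real n) * G X Y p)"
    if "X \<in> \<X>" "Y \<in> \<X>" for X Y p
    using soliton[OF that, of p] by (simp add: algebra_simps)
  with \<alpha> have "ricci_tensor A D X Y p = - (2 * real n) * G X Y p"
    if "X \<in> \<X>" "Y \<in> \<X>" for X Y p
    using that by (metis mult_left_cancel)
  then show ?thesis unfolding einstein_manifold_def by blast
qed

end
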